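(* Let $(M_n)_{n \geq 1}$ be an arbitrary sequence of positive numbers tending to $\infty$. Then there exists an analytic map $\varphi \colon \mathbb{D} \to \mathbb{D}$ with $\varphi \in \mathcal{D}$ such that: 1) $\|\varphi^{n}\|_{\mathcal{D}} = O(M_n)$ as $n\to \infty$, where $\varphi^n$ denotes the $n$-th (pointwise multiplicative) power of $\varphi$; 2) $\varphi$ is not a symbol on $\mathcal{D}$, i.e. the composition operator $C_\varphi \colon f \mapsto f\circ\varphi$ is not a bounded operator from $\mathcal{D}$ to $\mathcal{D}$.
   Context: $\mathbb{D}$ is the open unit disk of $\mathbb{C}$ and $dA = dx\,dy/\pi$ is the normalized area measure on $\mathbb{D}$. The Dirichlet space $\mathcal{D}$ is the Hilbert space of analytic functions $f \colon \mathbb{D} \to \mathbb{C}$ such that $\|f\|_{\mathcal{D}}^2 := |f(0)|^2 + \int_{\mathbb{D}} |f'(z)|^2 \, dA(z) < +\infty$. An analytic self-map $\varphi$ of $\mathbb{D}$ is called a symbol on $\mathcal{D}$ if $f \mapsto f \circ \varphi$ defines a bounded operator on $\mathcal{D}$. *)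

theory Defs
  imports "HOL-Complex_Analysis.Complex_Analysis" "HOL-Library.Landau_Symbols"
begin

text \<open>
  Functions on the open unit disk \<^term>\<open>ball (0::complex) 1\<close> are represented by total functions on
  the complex plane; every notion below depends only on their values on the disk. The factor
  \<^term>\<open>1 / pi\<close> normalises Lebesgue measure on the plane to the area measure \<open>dA = dx dy / \<pi>\<close>.
\<close>

definition dirichlet_space :: "(complex \<Rightarrow> complex) set" where
  "dirichlet_space =
     {f. f holomorphic_on ball 0 1 \<and>
         set_integrable lborel (ball 0 1) (\<lambda>z. (cmod (deriv f z))\<^sup>2)}"

definition dirichlet_norm :: "(complex \<Rightarrow> complex) \<Rightarrow> real" where
  "dirichlet_norm f =
     sqrt ((cmod (f 0))\<^sup>2 + (1 / pi) * (LINT z:ball 0 1|lborel. (cmod (deriv f z))\<^sup>2))"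

definition analytic_self_map :: "(complex \<Rightarrow> complex) \<Rightarrow> bool" where
  "analytic_self_map \<phi> \<longleftrightarrow> \<phi> holomorphic_on ball 0 1 \<and> \<phi> ` ball 0 1 \<subseteq> ball 0 1"

definition dirichlet_symbol :: "(complex \<Rightarrow> complex) \<Rightarrow> bool" where
  "dirichlet_symbol \<phi> \<longleftrightarrow>
     analytic_self_map \<phi> \<and>
     (\<forall>f\<in>dirichlet_space. f \<circ> \<phi> \<in> dirichlet_space) \<and>
     (\<exists>C. \<forall>f\<in>dirichlet_space. dirichlet_norm (f \<circ> \<phi>) \<le> C * dirichlet_norm f)"

text \<open>
  Outside \<^const>\<open>dirichlet_space\<close> the Bochner integral in \<^const>\<open>dirichlet_norm\<close> is a dummy value. The
  next fact shows that the norms of powers of a self-map in the space are always genuine.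
\<close>

lemma power_mem_dirichlet_space:
  assumes "analytic_self_map \<phi>" and "\<phi> \<in> dirichlet_space"
  shows "(\<lambda>z. \<phi> z ^ n) \<in> dirichlet_space"
proof -
  let ?D = "ball (0::complex) 1"
  have hol: "\<phi> holomorphic_on ?D" and sub: "\<And>z. z \<in> ?D \<Longrightarrow> cmod (\<phi> z) < 1"
    using assms(1) by (auto simp: analytic_self_map_def image_subset_iff)
  have int: "set_integrable lborel ?D (\<lambda>z. (cmod (deriv \<phi> z))\<^sup>2)"
    using assms(2) by (simp add: dirichlet_space_def)
  have holn: "(\<lambda>z. \<phi> z ^ n) holomorphic_on ?D"
    using hol by (intro holomorphic_intros)
  have "set_borel_measurable lborel ?D (\<lambda>z. (cmod (deriv (\<lambda>z. \<phi> z ^ n) z))\<^sup>2)"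
  proof -
    have "continuous_on ?D (\<lambda>z. (cmod (deriv (\<lambda>z. \<phi> z ^ n) z))\<^sup>2)"
      by (intro continuous_intros holomorphic_on_imp_continuous_on holomorphic_deriv holn open_ball)
    then have "set_borel_measurable borel ?D (\<lambda>z. (cmod (deriv (\<lambda>z. \<phi> z ^ n) z))\<^sup>2)"
      unfolding set_borel_measurable_def by (intro borel_measurable_continuous_on_indicator) auto
    then show ?thesis by (simp add: set_borel_measurable_def)
  qed
  moreover have "cmod (deriv (\<lambda>z. \<phi> z ^ n) z) ^ 2 \<le> (real n)\<^sup>2 * (cmod (deriv \<phi> z))\<^sup>2"
    if "z \<in> ?D" for z
  proof -
    have "(\<phi> has_field_derivative deriv \<phi> z) (at z)"
      using hol that by (intro holomorphic_derivI[where S = ?D]) auto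
    then have "deriv (\<lambda>z. \<phi> z ^ n) z = of_nat n * (deriv \<phi> z * \<phi> z ^ (n - Suc 0))"
      by (intro DERIV_imp_deriv DERIV_power)
    then have "cmod (deriv (\<lambda>z. \<phi> z ^ n) z) =
        real n * cmod (deriv \<phi> z) * cmod (\<phi> z) ^ (n - Suc 0)"
      by (simp add: norm_mult norm_power)
    also have "\<dots> \<le> real n * cmod (deriv \<phi> z)"
      using sub[OF that] by (intro mult_left_le power_le_one) auto
    finally have "(cmod (deriv (\<lambda>z. \<phi> z ^ n) z))\<^sup>2 \<le> (real n * cmod (deriv \<phi> z))\<^sup>2"
      by (intro power_mono) auto
    then show ?thesis by (simp add: power_mult_distrib)
  qed
  moreover have "set_integrable lborel ?D (\<lambda>z. (real n)\<^sup>2 * (cmod (deriv \<phi> z))\<^sup>2)"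
    using int by simp
  ultimately have "set_integrable lborel ?D (\<lambda>z. (cmod (deriv (\<lambda>z. \<phi> z ^ n) z))\<^sup>2)"
    by (elim set_integrable_bound) (auto intro!: AE_I2)
  with holn show ?thesis by (simp add: dirichlet_space_def)
qed

end

theory Submission
  imports Defs "HOL-Library.Discrete_Functions"
begin

text \<open>
  Put \<open>b\<^sub>d(z) = bump (d / (1 - z))\<close>. These functions have values in the sector \<open>|Im| \<le> Re\<close>, are
  concentrated at \<open>|1 - z| \<approx> d\<close>, are essentially dilates of each other, and satisfy
  \<open>|b\<^sub>d'(z)| \<le> |b\<^sub>d(z)| / (2 |1 - z|)\<close>. Take \<open>\<phi> = 1 - \<Sum>\<^sub>j c\<^sub>j b\<^sub>d\<^sub>j\<close> with the scales \<open>d\<^sub>j\<close> tending to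
  \<open>0\<close> so fast that near \<open>|1 - z| \<approx> d\<^sub>j\<close> only the \<open>j\<close>-th term matters.

  Since the sector is a cone, the terms do not cancel, and the \<open>j\<close>-th term contributes at most a
  constant times \<open>min 1 (n c\<^sub>j)\<close> to the squared norm of \<open>\<phi>\<^sup>n\<close>, whatever \<open>d\<^sub>j\<close> is. If the \<open>c\<^sub>j\<close>
  decrease fast, the sum of these contributions grows as slowly as desired, even when a value \<open>h\<close> is
  taken by arbitrarily many \<open>c\<^sub>j\<close>. But then \<open>\<phi>\<close> covers the part of a sector at distance about \<open>h\<close>
  from \<open>1\<close> as many times, and the functions \<open>h / (1 + h - z)\<close>, whose norms are bounded, are mapped by
  \<open>C\<^sub>\<phi>\<close> to functions of arbitrarily large norm.
\<close>

section \<open>The bump function\<close>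

text \<open>With \<open>s = csqrt w\<close> and \<open>w\<close> in the right half-plane this is
  \<open>1 / (s + 1 / s)\<close>: comparable to \<open>s\<close> for small \<open>w\<close> and to
  \<open>1 / s\<close> for large \<open>w\<close>, hence concentrated around
  \<open>|w| = 1\<close>.\<close>

definition bump :: "complex \<Rightarrow> complex" where
  "bump w = csqrt w / (1 + w)"

lemma norm_one_plus_ge:
  fixes w :: complex
  assumes "Re w > 0"
  shows "cmod (1 + w) \<ge> 1" and "cmod (1 + w) \<ge> cmod w" and "cmod (1 - w) \<le> cmod (1 + w)"
proof -
  show "cmod (1 + w) \<ge> 1"
    using complex_Re_le_cmod[of "1 + w"] assms by simp
  have *: "(cmod (1 + w))\<^sup>2 = 1 + 2 * Re w + (cmod w)\<^sup>2" "(cmod (1 - w))\<^sup>2 = 1 - 2 * Re w + (cmod w)\<^sup>2"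
    unfolding cmod_power2 by (simp_all add: power2_eq_square algebra_simps)
  show "cmod (1 + w) \<ge> cmod w" "cmod (1 - w) \<le> cmod (1 + w)"
    by (rule power2_le_imp_le; use * assms in simp)+
qed

lemma csqrt_in_sector:
  assumes "Re w > 0"
  shows "\<bar>Im (csqrt w)\<bar> \<le> Re (csqrt w)"
proof -
  have "Re w = (Re (csqrt w))\<^sup>2 - (Im (csqrt w))\<^sup>2"
    using arg_cong[OF power2_csqrt[of w], of Re] unfolding power2_eq_square times_complex.sel by simp
  hence "(Im (csqrt w))\<^sup>2 \<le> (Re (csqrt w))\<^sup>2" using assms by linarith
  hence "\<bar>Im (csqrt w)\<bar> \<le> \<bar>Re (csqrt w)\<bar>" unfolding abs_le_square_iff .
  moreover have "0 \<le> Re (csqrt w)" using csqrt_principal[of w] by linarith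
  ultimately show ?thesis by linarith
qed

lemma inverse_in_sector:
  fixes z :: complex
  assumes "\<bar>Im z\<bar> \<le> Re z"
  shows "\<bar>Im (inverse z)\<bar> \<le> Re (inverse z)"
  using assms by (auto simp: abs_divide intro!: divide_right_mono)

text \<open>The source of non-cancellation: on the sector the norm is comparable to the real part,
  and real parts add up.\<close>

lemma norm_le_Re_in_sector:
  fixes z :: complex
  assumes "\<bar>Im z\<bar> \<le> Re z"
  shows "cmod z \<le> sqrt 2 * Re z"
proof -
  have "(Im z)\<^sup>2 \<le> (Re z)\<^sup>2" using assms by (simp add: abs_le_square_iff[symmetric])
  hence "(cmod z)\<^sup>2 \<le> (sqrt 2 * Re z)\<^sup>2"
    by (simp add: cmod_power2 power_mult_distrib)
  moreover have "0 \<le> Re z" using assms by linarith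
  ultimately show ?thesis by (auto intro: power2_le_imp_le)
qed

context
  fixes w :: complex
  assumes w: "Re w > 0"
begin

lemma bump_nz: "w \<noteq> 0" "1 + w \<noteq> 0" "csqrt w \<noteq> 0"
  using w norm_one_plus_ge(1)[OF w] by auto

text \<open>The sector is closed under addition and inversion and contains \<open>csqrt w\<close>,
  so it contains the inverse of \<open>csqrt w + inverse (csqrt w)\<close>.\<close>

lemma bump_in_sector: "\<bar>Im (bump w)\<bar> \<le> Re (bump w)"
proof -
  have "bump w = inverse (csqrt w + inverse (csqrt w))"
    using bump_nz power2_csqrt[of w] unfolding bump_def power2_eq_square
    by (simp add: field_simps)
  moreover have "\<bar>Im (csqrt w + inverse (csqrt w))\<bar> \<le> Re (csqrt w + inverse (csqrt w))"
    using csqrt_in_sector[OF w] inverse_in_sector[OF csqrt_in_sector[OF w]] 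
    unfolding plus_complex.sel by linarith
  ultimately show ?thesis using inverse_in_sector by metis
qed

lemma norm_bump_le: "cmod (bump w) \<le> sqrt (cmod w)" "cmod (bump w) \<le> 1 / sqrt (cmod w)"
proof -
  show "cmod (bump w) \<le> sqrt (cmod w)"
    using norm_one_plus_ge(1)[OF w] 
    by (simp add: bump_def norm_divide divide_le_eq mult_le_cancel_left1)
  have "cmod (bump w) = sqrt (cmod w) / cmod (1 + w)"
    by (simp add: bump_def norm_divide)
  also have "\<dots> \<le> sqrt (cmod w) / cmod w"
    using norm_one_plus_ge(2)[OF w] bump_nz by (intro divide_left_mono) auto
  also have "\<dots> = 1 / sqrt (cmod w)"
    by (simp add: sqrt_divide_self_eq inverse_eq_divide)
  finally show "cmod (bump w) \<le> 1 / sqrt (cmod w)" .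
qed

lemma norm_bump_ge: "cmod (bump w) \<ge> min (sqrt (cmod w)) (1 / sqrt (cmod w)) / 2"
proof -
  define s where "s = sqrt (cmod w)"
  have s: "s > 0" "cmod w = s\<^sup>2" using bump_nz by (auto simp: s_def)
  have "cmod (1 + w) \<le> 1 + s\<^sup>2" using norm_triangle_ineq[of 1 w] s by simp
  hence "cmod (bump w) \<ge> s / (1 + s\<^sup>2)" using bump_nz s
    by (auto simp: bump_def norm_divide s_def[symmetric] intro!: divide_left_mono mult_pos_pos add_pos_pos)
  moreover have "s / (1 + s\<^sup>2) \<ge> min s (1 / s) / 2"
  proof (cases "s \<le> 1")
    case True
    have "s * s \<le> 1" using True s by (simp add: mult_le_one)
    hence "s / 2 \<le> s / (1 + s\<^sup>2)" using s by (intro divide_left_mono) (auto simp: power2_eq_square add_pos_pos)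
    moreover have "min s (1 / s) / 2 \<le> s / 2" by simp
    ultimately show ?thesis by (rule order_trans[rotated])
  next
    case False
    have "s * 1 \<le> s * s" using False s by (intro mult_left_mono) auto
    hence "1 + s * s \<le> 2 * (s * s)" using False by linarith
    hence "1 / (2 * s) \<le> s / (1 + s * s)" using s
      by (intro mult_imp_div_pos_le) (auto simp: add_pos_pos pos_le_divide_eq mult_ac)
    hence "1 / (2 * s) \<le> s / (1 + s\<^sup>2)" by (simp add: power2_eq_square)
    moreover have "min s (1 / s) / 2 \<le> 1 / (2 * s)" by simp
    ultimately show ?thesis by (rule order_trans[rotated])
  qed
  ultimately show ?thesis unfolding s_def by (rule order_trans[rotated])
qed

lemma Re_bump_ge: "Re (bump w) \<ge> min (sqrt (cmod w)) (1 / sqrt (cmod w)) / 4"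
proof -
  have "sqrt 2 \<le> 2" by (rule real_le_lsqrt) auto
  moreover have "Re (bump w) \<ge> 0" using bump_in_sector by linarith
  ultimately have "sqrt 2 * Re (bump w) \<le> 2 * Re (bump w)" by (intro mult_right_mono)
  hence "min (sqrt (cmod w)) (1 / sqrt (cmod w)) / 2 \<le> 2 * Re (bump w)"
    using norm_bump_ge norm_le_Re_in_sector[OF bump_in_sector] by linarith
  thus ?thesis by simp
qed

lemma Re_bump_pos: "Re (bump w) > 0"
proof -
  have "0 < min (sqrt (cmod w)) (1 / sqrt (cmod w)) / 4" using bump_nz by simp
  thus ?thesis using Re_bump_ge by (rule less_le_trans)
qed

lemma norm_bump_le_1: "cmod (bump w) \<le> 1"
proof (cases "sqrt (cmod w) \<le> 1")
  case True
  thus ?thesis using norm_bump_le(1) by (rule order_trans[rotated])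
next
  case False
  hence "1 / sqrt (cmod w) \<le> 1" by (intro divide_le_eq_1[THEN iffD2]) auto
  thus ?thesis using norm_bump_le(2) by (rule order_trans[rotated])
qed

text \<open>The derivative is written as \<open>bump w / (2 * w)\<close> times the Cayley factor
  \<open>(1 - w) / (1 + w)\<close>. That factor has norm at most 1 on the right half-plane, which
  gives upper bounds, and vanishes only at \<open>w = 1\<close>, which must be avoided for lower
  bounds.\<close>

lemma bump_has_field_derivative:
  "(bump has_field_derivative bump w * ((1 - w) / (1 + w)) / (2 * w)) (at w)"
proof -
  have "w \<notin> \<real>\<^sub>\<le>\<^sub>0" using w by (auto simp: complex_nonpos_Reals_iff)
  hence "((\<lambda>w. csqrt w / (1 + w)) has_field_derivative
     (inverse (2 * csqrt w) * (1 + w) - csqrt w * 1) / ((1 + w) * (1 + w))) (at w)"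
    using bump_nz by (auto intro!: derivative_eq_intros simp: field_simps)
  moreover have "(inverse (2 * csqrt w) * (1 + w) - csqrt w * 1) / ((1 + w) * (1 + w))
      = bump w * ((1 - w) / (1 + w)) / (2 * w)"
  proof -
    have "csqrt w * csqrt w = w" using power2_csqrt[of w] by (simp add: power2_eq_square)
    then obtain s where s: "csqrt w = s" "w = s * s" by metis
    have "s \<noteq> 0" "1 + s * s \<noteq> 0" using bump_nz s by auto
    thus ?thesis unfolding bump_def s(1) unfolding s(2)
      by (simp add: divide_simps)
  qed
  ultimately show ?thesis by (simp add: bump_def[abs_def])
qed

end

section \<open>Integrals of radial weights and Dirichlet energy\<close>

lemma sqrt_four_power: "sqrt (4 ^ m) = 2 ^ m"
  by (simp add: real_sqrt_power)

lemma ennreal_le_suminf: "f k \<le> (\<Sum>m. f m)" for f :: "nat \<Rightarrow> ennreal"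
  using sum_le_suminf[of f "{k}"] by simp

text \<open>Radial weights are integrated by layers: a majorant that is a combination of indicators
  of concentric balls has an explicit integral.\<close>

lemma nn_integral_suminf_balls:
  fixes a :: complex and c \<rho> :: "nat \<Rightarrow> real"
  assumes "\<And>m. c m \<ge> 0" "\<And>m. \<rho> m \<ge> 0" and S: "(\<lambda>m. c m * (pi * (\<rho> m)\<^sup>2)) sums S"
    and le: "\<And>z. f z \<le> (\<Sum>m. ennreal (c m) * indicator (ball a (\<rho> m)) z)"
  shows "(\<integral>\<^sup>+z. f z \<partial>lborel) \<le> ennreal S"
proof -
  have "(\<integral>\<^sup>+z. f z \<partial>lborel) \<le> (\<integral>\<^sup>+z. (\<Sum>m. ennreal (c m) * indicator (ball a (\<rho> m)) z) \<partial>lborel)"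
    by (intro nn_integral_mono le)
  also have "\<dots> = (\<Sum>m. \<integral>\<^sup>+z. ennreal (c m) * indicator (ball a (\<rho> m)) z \<partial>lborel)"
    by (intro nn_integral_suminf borel_measurable_times_ennreal borel_measurable_indicator) auto
  also have "\<dots> = (\<Sum>m. ennreal (c m * (pi * (\<rho> m)\<^sup>2)))"
    using assms(1,2) by (subst nn_integral_cmult_indicator)
      (simp_all add: emeasure_ball unit_ball_vol_2 ennreal_mult)
  also have "\<dots> = ennreal S"
    using assms by (intro suminf_ennreal_eq) auto
  finally show ?thesis .
qed

text \<open>On the annulus \<open>R / 4 ^ Suc k <= r < R / 4 ^ k\<close> the weight
  \<open>r^(-3/2)\<close> is at most \<open>8 ^ Suc k / R^(3/2)\<close>, and the area of the
  enclosing ball decays like \<open>16^(-k)\<close>; this leaves a geometric series of ratio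
  \<open>1 / 2\<close>. Powers of 4 keep the square roots rational.\<close>

lemma nn_integral_inner_power:
  fixes a :: complex
  assumes R: "R > 0"
  shows "(\<integral>\<^sup>+z. ennreal (if dist a z < R then 1 / (dist a z * sqrt (dist a z)) else 0) \<partial>lborel)
     \<le> ennreal (16 * pi * sqrt R)"
proof (rule nn_integral_suminf_balls[where a = a and c = "\<lambda>m. 8 ^ Suc m / (R * sqrt R)" and \<rho> = "\<lambda>m. R / 4 ^ m"])
  show "8 ^ Suc m / (R * sqrt R) \<ge> 0" "R / 4 ^ m \<ge> 0" for m using R by auto
  have "8 ^ Suc m / (R * sqrt R) * (pi * (R / 4 ^ m)\<^sup>2) = 8 * pi * sqrt R * (1 / 2) ^ m" for m
  proof -
    have 8: "(8::real) ^ Suc m = 8 * (2 ^ m * 4 ^ m)" by (simp flip: power_mult_distrib)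
    have 4: "(4::real) ^ m = 2 ^ m * 2 ^ m" by (simp flip: power_mult_distrib)
    define S where "S = sqrt R"
    have S: "R = S * S" "S > 0" using R by (auto simp: S_def)
    have "sqrt R = S" by (simp add: S_def)
    thus ?thesis unfolding 8 4 using S(2)
      by (simp add: field_simps power2_eq_square S(1))
  qed
  moreover have "(\<lambda>m. 8 * pi * sqrt R * (1 / 2) ^ m) sums (8 * pi * sqrt R * (1 / (1 - 1 / 2)))"
    by (intro sums_mult geometric_sums) auto
  moreover have "8 * pi * sqrt R * (1 / (1 - 1 / 2)) = 16 * pi * sqrt R" by simp
  ultimately show "(\<lambda>m. 8 ^ Suc m / (R * sqrt R) * (pi * (R / 4 ^ m)\<^sup>2)) sums (16 * pi * sqrt R)"
    by (simp only:)
next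
  fix z
  let ?g = "\<lambda>m. ennreal (8 ^ Suc m / (R * sqrt R)) * indicator (ball a (R / 4 ^ m)) z"
  show "ennreal (if dist a z < R then 1 / (dist a z * sqrt (dist a z)) else 0) \<le> (\<Sum>m. ?g m)"
  proof (cases "0 < dist a z \<and> dist a z < R")
    \<comment> \<open>This case includes \<open>z = a\<close>, where division by zero makes the
      weight \<open>0\<close>.\<close>
    case False
    thus ?thesis by (auto simp: not_less)
  next
    case True
    define r where "r = dist a z"
    have r: "0 < r" "r < R" using True by (auto simp: r_def)
    have ex: "\<exists>m. R / r \<le> 4 ^ m" using real_arch_pow[of 4 "R / r"] by (auto intro: less_imp_le)
    define m where "m = (LEAST m. R / r \<le> 4 ^ m)"
    have m: "R / r \<le> 4 ^ m" unfolding m_def by (rule LeastI_ex) fact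
    have "m \<noteq> 0"
    proof
      assume "m = 0"
      with m r show False by (simp add: divide_le_eq)
    qed
    then obtain k where k: "m = Suc k" by (cases m) auto
    have "\<not> R / r \<le> 4 ^ k" using not_less_Least[of k "\<lambda>m. R / r \<le> 4 ^ m"] k m_def by auto
    hence k1: "r < R / 4 ^ k" using r by (simp add: field_simps)
    have k2: "R \<le> 4 ^ Suc k * r" using m r unfolding k by (simp add: field_simps)
    have "R * sqrt R \<le> (4 ^ Suc k * r) * sqrt (4 ^ Suc k * r)"
      using r R by (intro mult_mono k2 real_sqrt_le_mono) auto
    also have "\<dots> = 4 ^ Suc k * 2 ^ Suc k * (r * sqrt r)"
      unfolding real_sqrt_mult sqrt_four_power by (simp only: mult_ac)
    also have "4 ^ Suc k * 2 ^ Suc k = (8::real) ^ Suc k"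
      unfolding power_mult_distrib[symmetric] by simp
    finally have *: "R * sqrt R \<le> 8 ^ Suc k * (r * sqrt r)" .
    have "y \<le> c * x \<Longrightarrow> 1 / x \<le> c / y" if "x > 0" "y > 0" for c x y :: real
      using that by (simp add: field_simps)
    from this[OF _ _ *] have "1 / (r * sqrt r) \<le> 8 ^ Suc k / (R * sqrt R)"
      using r R by simp
    hence "ennreal (1 / (r * sqrt r)) \<le> ?g k"
      using k1 by (simp add: r_def ennreal_leI)
    also have "\<dots> \<le> (\<Sum>m. ?g m)"
      by (rule ennreal_le_suminf)
    finally show ?thesis using r by (simp add: r_def)
  qed
qed

text \<open>The same layering outwards: on \<open>4 ^ k * R <= r < 4 ^ Suc k * R\<close> the weight
  \<open>r^(-5/2)\<close> is at most \<open>32^(-k) * R^(-5/2)\<close>, while areas grow like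
  \<open>16^k\<close>.\<close>

lemma nn_integral_outer_power:
  fixes a :: complex
  assumes R: "R > 0"
  shows "(\<integral>\<^sup>+z. ennreal (if R \<le> dist a z then 1 / ((dist a z)\<^sup>2 * sqrt (dist a z)) else 0) \<partial>lborel)
     \<le> ennreal (32 * pi / sqrt R)"
proof (rule nn_integral_suminf_balls[where a = a and c = "\<lambda>m. 1 / (32 ^ m * (R\<^sup>2 * sqrt R))" and \<rho> = "\<lambda>m. R * 4 ^ Suc m"])
  show "1 / (32 ^ m * (R\<^sup>2 * sqrt R)) \<ge> 0" "R * 4 ^ Suc m \<ge> 0" for m using R by auto
  have "1 / (32 ^ m * (R\<^sup>2 * sqrt R)) * (pi * (R * 4 ^ Suc m)\<^sup>2) = 16 * pi / sqrt R * (1 / 2) ^ m" for m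
  proof -
    have "(32::real) ^ m = 2 ^ m * (4 ^ m * 4 ^ m)" by (simp flip: power_mult_distrib)
    moreover have "sqrt R \<noteq> 0" using R by simp
    ultimately show ?thesis using R
      by (simp add: field_simps power2_eq_square)
  qed
  moreover have "(\<lambda>m. 16 * pi / sqrt R * (1 / 2) ^ m) sums (16 * pi / sqrt R * (1 / (1 - 1 / 2)))"
    by (intro sums_mult geometric_sums) auto
  moreover have "16 * pi / sqrt R * (1 / (1 - 1 / 2)) = 32 * pi / sqrt R" by simp
  ultimately show "(\<lambda>m. 1 / (32 ^ m * (R\<^sup>2 * sqrt R)) * (pi * (R * 4 ^ Suc m)\<^sup>2)) sums (32 * pi / sqrt R)"
    by (simp only:)
next
  fix z
  let ?g = "\<lambda>m. ennreal (1 / (32 ^ m * (R\<^sup>2 * sqrt R))) * indicator (ball a (R * 4 ^ Suc m)) z"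
  show "ennreal (if R \<le> dist a z then 1 / ((dist a z)\<^sup>2 * sqrt (dist a z)) else 0) \<le> (\<Sum>m. ?g m)"
  proof (cases "R \<le> dist a z")
    case False
    thus ?thesis by auto
  next
    case True
    define r where "r = dist a z"
    have r: "0 < r" "R \<le> r" using True R by (auto simp: r_def)
    have ex: "\<exists>m. r / R < 4 ^ m" using real_arch_pow[of 4 "r / R"] by auto
    define m where "m = (LEAST m. r / R < 4 ^ m)"
    have m: "r / R < 4 ^ m" unfolding m_def by (rule LeastI_ex) fact
    have "m \<noteq> 0"
    proof
      assume "m = 0"
      with m r R show False by (simp add: divide_less_eq)
    qed
    then obtain k where k: "m = Suc k" by (cases m) auto
    have "\<not> r / R < 4 ^ k" using not_less_Least[of k "\<lambda>m. r / R < 4 ^ m"] k m_def by auto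
    hence k1: "4 ^ k * R \<le> r" using R by (simp add: field_simps)
    have k2: "r < R * 4 ^ Suc k" using m R unfolding k by (simp add: field_simps)
    have "32 ^ k * (R\<^sup>2 * sqrt R) = (4 ^ k * R)\<^sup>2 * sqrt (4 ^ k * R)"
    proof -
      have "(32::real) ^ k = 2 ^ k * (4 ^ k * 4 ^ k)" by (simp flip: power_mult_distrib)
      thus ?thesis unfolding real_sqrt_mult sqrt_four_power by (simp add: power2_eq_square)
    qed
    also have "\<dots> \<le> r\<^sup>2 * sqrt r"
      using k1 r R by (intro mult_mono power_mono) auto
    finally have "1 / (r\<^sup>2 * sqrt r) \<le> 1 / (32 ^ k * (R\<^sup>2 * sqrt R))"
      using r R by (intro divide_left_mono) auto
    hence "ennreal (1 / (r\<^sup>2 * sqrt r)) \<le> ?g k"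
      using k2 by (simp add: r_def ennreal_leI)
    also have "\<dots> \<le> (\<Sum>m. ?g m)"
      by (rule ennreal_le_suminf)
    finally show ?thesis using r by (simp add: r_def)
  qed
qed

text \<open>A bump at scale \<open>d\<close> is of order \<open>sqrt (r / d)\<close> for
  \<open>r = |1 - z|\<close> below \<open>d\<close> and \<open>sqrt (d / r)\<close> above it.
  Multiplied by the weight \<open>1 / r^2\<close> these give, up to constants, the profiles
  \<open>r^(-3/2)\<close> here and \<open>r^(-5/2)\<close> in \<open>outer_kernel\<close>.\<close>

definition inner_kernel :: "real \<Rightarrow> complex \<Rightarrow> real" where
  "inner_kernel R z = (if dist 1 z < R then 1 / (dist 1 z * sqrt (dist 1 z)) else 0)"

definition outer_kernel :: "real \<Rightarrow> complex \<Rightarrow> real" where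
  "outer_kernel R z = (if R \<le> dist 1 z then 1 / ((dist 1 z)\<^sup>2 * sqrt (dist 1 z)) else 0)"

lemma kernel_measurable [measurable]:
  "inner_kernel R \<in> borel_measurable borel" "outer_kernel R \<in> borel_measurable borel"
  unfolding inner_kernel_def[abs_def] outer_kernel_def[abs_def] by measurable

lemma kernel_nonneg: "inner_kernel R z \<ge> 0" "outer_kernel R z \<ge> 0"
  by (auto simp: inner_kernel_def outer_kernel_def)

lemma nn_integral_kernels_le:
  assumes "R > 0" "S > 0" "\<alpha> \<ge> 0" "\<beta> \<ge> 0"
  shows "(\<integral>\<^sup>+z. ennreal (\<alpha> * inner_kernel R z + \<beta> * outer_kernel S z) \<partial>lborel)
     \<le> ennreal (\<alpha> * (16 * pi * sqrt R) + \<beta> * (32 * pi / sqrt S))"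
proof -
  have "(\<integral>\<^sup>+z. ennreal (\<alpha> * inner_kernel R z + \<beta> * outer_kernel S z) \<partial>lborel)
     = (\<integral>\<^sup>+z. ennreal \<alpha> * ennreal (inner_kernel R z) + ennreal \<beta> * ennreal (outer_kernel S z) \<partial>lborel)"
    using assms by (intro nn_integral_cong) (auto simp: ennreal_mult ennreal_plus kernel_nonneg)
  also have "\<dots> = ennreal \<alpha> * (\<integral>\<^sup>+z. ennreal (inner_kernel R z) \<partial>lborel)
      + ennreal \<beta> * (\<integral>\<^sup>+z. ennreal (outer_kernel S z) \<partial>lborel)"
    by (subst nn_integral_add) (auto simp: nn_integral_cmult)
  also have "\<dots> \<le> ennreal \<alpha> * ennreal (16 * pi * sqrt R) + ennreal \<beta> * ennreal (32 * pi / sqrt S)"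
    unfolding inner_kernel_def outer_kernel_def using assms
    by (intro add_mono mult_left_mono nn_integral_inner_power nn_integral_outer_power) auto
  also have "\<dots> = ennreal (\<alpha> * (16 * pi * sqrt R) + \<beta> * (32 * pi / sqrt S))"
    using assms by (simp flip: ennreal_mult ennreal_plus)
  finally show ?thesis .
qed

section \<open>The energy contributed by a single bump\<close>

lemma nn_integral_indicator_mono:
  assumes "\<And>z. z \<in> A \<Longrightarrow> f z \<le> g z"
  shows "(\<integral>\<^sup>+z. f z * indicator A z \<partial>M) \<le> (\<integral>\<^sup>+z. g z \<partial>M)"
  using assms by (intro nn_integral_mono) (simp add: indicator_def)

text \<open>The bounds \<open>x\<close> and \<open>8 / x\<close> serve small and large
  \<open>x\<close>. The bound \<open>1\<close> is for discarding one of two equal factors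
  \<open>x * exp (- x / 2)\<close>.\<close>

lemma mult_exp_le:
  fixes x :: real
  assumes "x > 0"
  shows "x * exp (- x / 2) \<le> x" "x * exp (- x / 2) \<le> 8 / x" "x * exp (- x / 2) \<le> 1"
proof -
  show "x * exp (- x / 2) \<le> x" using assms by simp
  have "1 + x / 2 + (x / 2)\<^sup>2 / 2 \<le> exp (x / 2)"
    using assms by (intro exp_lower_Taylor_quadratic) auto
  hence "x * x \<le> 8 * exp (x / 2)" using assms by (simp add: power2_eq_square field_simps)
  thus "x * exp (- x / 2) \<le> 8 / x" using assms by (simp add: exp_minus field_simps)
  have "2 * (x / 2) \<le> exp 1 * exp (x / 2 - 1)"
    using assms exp_ge_add_one_self[of 1] exp_ge_add_one_self[of "x / 2 - 1"] by (intro mult_mono) auto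
  also have "\<dots> = exp (x / 2)" by (simp flip: exp_add)
  finally show "x * exp (- x / 2) \<le> 1" using assms by (simp add: exp_minus field_simps)
qed

lemma disc_quotient:
  assumes "z \<in> ball 0 1" "\<delta> > 0"
  shows "Re (of_real \<delta> / (1 - z)) > 0" "cmod (of_real \<delta> / (1 - z)) = \<delta> / dist 1 z" "dist 1 z > 0"
proof -
  have "Re z < 1" using assms complex_Re_le_cmod[of z] by simp
  hence *: "Re (1 - z) > 0" by simp
  moreover have "Re (of_real \<delta> / (1 - z)) = \<delta> * Re (1 - z) / (cmod (1 - z))\<^sup>2"
    by (simp add: Re_divide cmod_power2)
  moreover have "1 - z \<noteq> 0" using * by auto
  ultimately show "Re (of_real \<delta> / (1 - z)) > 0" using assms by auto
  show "dist 1 z > 0" using * by auto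
  show "cmod (of_real \<delta> / (1 - z)) = \<delta> / dist 1 z" using assms by (simp add: norm_divide dist_norm)
qed

text \<open>The bound \<open>C min 1 t\<close> does not depend on the position \<open>\<delta>\<close>: dilations about \<open>1\<close> preserve
  the measure \<open>dA(z) / |1 - z|\<^sup>2\<close>.\<close>

lemma nn_integral_bump_weight_le:
  assumes \<delta>: "\<delta> > 0" and t: "t > 0"
  defines "x \<equiv> \<lambda>z. t * Re (bump (of_real \<delta> / (1 - z)))"
  shows "(\<integral>\<^sup>+z. ennreal (x z * exp (- x z / 2) / (dist 1 z)\<^sup>2) * indicator (ball 0 1) z \<partial>lborel)
    \<le> ennreal (1584 * pi * min 1 t)"
proof -
  let ?g = "\<lambda>z. x z * exp (- x z / 2) / (dist 1 z)\<^sup>2"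
  \<comment> \<open>The first majorant yields a bound linear in \<open>t\<close>, the second a bound
    free of \<open>t\<close>. The radii \<open>\<delta> / t\<^sup>2\<close> and
    \<open>\<delta> * t\<^sup>2\<close> are those at which \<open>t * sqrt (r / \<delta>)\<close>
    and \<open>t * sqrt (\<delta> / r)\<close> equal 1, that is, where \<open>x\<close> and
    \<open>8 / x\<close> exchange roles.\<close>
  have key: "?g z \<le> t / sqrt \<delta> * inner_kernel \<delta> z + t * sqrt \<delta> * outer_kernel \<delta> z"
      "?g z \<le> (t / sqrt \<delta> * inner_kernel (\<delta> / t\<^sup>2) z + 32 / t * sqrt \<delta> * outer_kernel (\<delta> / t\<^sup>2) z)
         + (32 / (t * sqrt \<delta>) * inner_kernel (\<delta> * t\<^sup>2) z + t * sqrt \<delta> * outer_kernel (\<delta> * t\<^sup>2) z)" (is "_ \<le> ?R")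
    if z: "z \<in> ball 0 1" for z
  proof -
    define r where "r = dist 1 z"
    define A where "A = sqrt r"
    define D where "D = sqrt \<delta>"
    have r: "r > 0" using disc_quotient[OF z \<delta>] by (simp add: r_def)
    have AD: "A > 0" "D > 0" "r = A * A" "\<delta> = D * D" using r \<delta> by (auto simp: A_def D_def)
    let ?w = "of_real \<delta> / (1 - z)"
    note w = disc_quotient(1)[OF z \<delta>]
    have sq: "sqrt (cmod ?w) = D / A"
      using disc_quotient(2)[OF z \<delta>] by (simp add: real_sqrt_divide r_def A_def D_def)
    let ?y = "Re (bump ?w)"
    have y: "?y > 0" "?y \<le> D / A" "?y \<le> A / D" "?y \<ge> min (D / A) (A / D) / 4"
      using Re_bump_pos[OF w] norm_bump_le[OF w] Re_bump_ge[OF w] complex_Re_le_cmod[of "bump ?w"]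
      by (auto simp: sq)
    have x: "x z > 0" "x z \<le> t * (D / A)" "x z \<le> t * (A / D)"
      using y t unfolding x_def by (auto intro!: mult_left_mono simp del: times_divide_eq_right)
    have b1: "?g z \<le> t / D * (1 / (r * A))"
    proof -
      have "x z * exp (- x z / 2) \<le> t * (A / D)" using mult_exp_le(1)[OF x(1)] x(3) by linarith
      hence "?g z \<le> t * (A / D) / r\<^sup>2" unfolding r_def by (rule divide_right_mono) simp
      thus ?thesis using AD by (simp add: power2_eq_square)
    qed
    have b2: "?g z \<le> t * D * (1 / (r\<^sup>2 * A))"
    proof -
      have "x z * exp (- x z / 2) \<le> t * (D / A)" using mult_exp_le(1)[OF x(1)] x(2) by linarith
      hence "?g z \<le> t * (D / A) / r\<^sup>2" unfolding r_def by (rule divide_right_mono) simp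
      thus ?thesis using AD by (simp add: mult_ac)
    qed
    \<comment> \<open>For large \<open>x z\<close> the bound \<open>8 / x z\<close> inverts the
      bump, so the inner side now produces the outer profile. The \<open>32\<close> is
      \<open>8\<close> from \<open>mult_exp_le\<close> times \<open>4\<close> from
      \<open>Re_bump_ge\<close>.\<close>
    have b3: "?g z \<le> 32 / t * D * (1 / (r\<^sup>2 * A))" if "r < \<delta>"
    proof -
      have "A < D" using that by (simp add: A_def D_def)
      hence "A / D \<le> D / A" using AD by (meson frac_le less_imp_le order_trans)
      hence "?y \<ge> A / D / 4" using y(4) by (simp only: min_absorb2)
      from mult_left_mono[OF this, of t] have "x z \<ge> t * (A / D) / 4" using t by (simp add: x_def)
      hence "8 / x z \<le> 8 / (t * (A / D) / 4)" using t AD x(1) by (intro divide_left_mono mult_pos_pos) auto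
      also have "\<dots> = 32 * D / (t * A)" by simp
      finally have "x z * exp (- x z / 2) \<le> 32 * D / (t * A)" using mult_exp_le(2)[OF x(1)] by linarith
      hence "?g z \<le> 32 * D / (t * A) / r\<^sup>2" unfolding r_def by (rule divide_right_mono) simp
      thus ?thesis by (simp add: mult_ac)
    qed
    have b4: "?g z \<le> 32 / (t * D) * (1 / (r * A))" if "\<delta> \<le> r"
    proof -
      have "D \<le> A" using that by (simp add: A_def D_def)
      hence "D / A \<le> A / D" using AD by (meson frac_le less_imp_le order_trans)
      hence "?y \<ge> D / A / 4" using y(4) by (simp only: min_absorb1)
      from mult_left_mono[OF this, of t] have "x z \<ge> t * (D / A) / 4" using t by (simp add: x_def)
      hence "8 / x z \<le> 8 / (t * (D / A) / 4)" using t AD x(1) by (intro divide_left_mono mult_pos_pos) auto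
      also have "\<dots> = 32 * A / (t * D)" by simp
      finally have "x z * exp (- x z / 2) \<le> 32 * A / (t * D)" using mult_exp_le(2)[OF x(1)] by linarith
      hence "?g z \<le> 32 * A / (t * D) / r\<^sup>2" unfolding r_def by (rule divide_right_mono) simp
      thus ?thesis using AD by (simp add: power2_eq_square)
    qed
    define P Q where "P = 1 / (r * A)" and "Q = 1 / (r\<^sup>2 * A)"
    note b = b1[folded P_def] b2[folded Q_def] b3[folded Q_def] b4[folded P_def]
    have kin: "inner_kernel R z = (if r < R then P else 0)" for R
      by (simp add: inner_kernel_def r_def A_def P_def)
    have kout: "outer_kernel R z = (if R \<le> r then Q else 0)" for R
      by (simp add: outer_kernel_def r_def A_def Q_def)
    show "?g z \<le> t / sqrt \<delta> * inner_kernel \<delta> z + t * sqrt \<delta> * outer_kernel \<delta> z"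
      using b(1,2) unfolding kin kout D_def[symmetric] by auto
    have nn: "t / D * inner_kernel (\<delta> / t\<^sup>2) z \<ge> 0" "32 / t * D * outer_kernel (\<delta> / t\<^sup>2) z \<ge> 0"
      "32 / (t * D) * inner_kernel (\<delta> * t\<^sup>2) z \<ge> 0" "t * D * outer_kernel (\<delta> * t\<^sup>2) z \<ge> 0"
      using t AD by (auto simp: kernel_nonneg intro!: mult_nonneg_nonneg)
    show "?g z \<le> ?R"
    proof (cases "r < \<delta>")
      case True
      have "?g z \<le> t / D * inner_kernel (\<delta> / t\<^sup>2) z + 32 / t * D * outer_kernel (\<delta> / t\<^sup>2) z"
        using b(1) b(3)[OF True] unfolding kin kout by auto
      thus ?thesis using nn unfolding D_def[symmetric] by linarith
    next
      case False
      have "?g z \<le> 32 / (t * D) * inner_kernel (\<delta> * t\<^sup>2) z + t * D * outer_kernel (\<delta> * t\<^sup>2) z"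
        using b(2,4) False unfolding kin kout by auto
      thus ?thesis using nn unfolding D_def[symmetric] by linarith
    qed
  qed
  let ?I = "\<integral>\<^sup>+z. ennreal (?g z) * indicator (ball 0 1) z \<partial>lborel"
  have 1: "?I \<le> ennreal (48 * pi * t)"
  proof -
    have "?I \<le> (\<integral>\<^sup>+z. ennreal (t / sqrt \<delta> * inner_kernel \<delta> z + t * sqrt \<delta> * outer_kernel \<delta> z) \<partial>lborel)"
      by (intro nn_integral_indicator_mono ennreal_leI key(1))
    also have "\<dots> \<le> ennreal (t / sqrt \<delta> * (16 * pi * sqrt \<delta>) + t * sqrt \<delta> * (32 * pi / sqrt \<delta>))"
      using \<delta> t by (intro nn_integral_kernels_le) auto
    also have "t / sqrt \<delta> * (16 * pi * sqrt \<delta>) + t * sqrt \<delta> * (32 * pi / sqrt \<delta>) = 48 * pi * t"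
      using \<delta> by simp
    finally show ?thesis .
  qed
  have 2: "?I \<le> ennreal (1584 * pi)"
  proof -
    have "?I \<le> (\<integral>\<^sup>+z. ennreal (t / sqrt \<delta> * inner_kernel (\<delta> / t\<^sup>2) z + 32 / t * sqrt \<delta> * outer_kernel (\<delta> / t\<^sup>2) z)
         + ennreal (32 / (t * sqrt \<delta>) * inner_kernel (\<delta> * t\<^sup>2) z + t * sqrt \<delta> * outer_kernel (\<delta> * t\<^sup>2) z) \<partial>lborel)"
    proof (rule nn_integral_indicator_mono)
      fix z :: complex assume z: "z \<in> ball 0 1"
      have nn: "t / sqrt \<delta> * inner_kernel (\<delta> / t\<^sup>2) z + 32 / t * sqrt \<delta> * outer_kernel (\<delta> / t\<^sup>2) z \<ge> 0"
        "32 / (t * sqrt \<delta>) * inner_kernel (\<delta> * t\<^sup>2) z + t * sqrt \<delta> * outer_kernel (\<delta> * t\<^sup>2) z \<ge> 0"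
        using \<delta> t by (intro add_nonneg_nonneg mult_nonneg_nonneg kernel_nonneg; simp)+
      show "ennreal (?g z) \<le> ennreal (t / sqrt \<delta> * inner_kernel (\<delta> / t\<^sup>2) z + 32 / t * sqrt \<delta> * outer_kernel (\<delta> / t\<^sup>2) z)
         + ennreal (32 / (t * sqrt \<delta>) * inner_kernel (\<delta> * t\<^sup>2) z + t * sqrt \<delta> * outer_kernel (\<delta> * t\<^sup>2) z)"
        unfolding ennreal_plus[OF nn, symmetric] by (intro ennreal_leI key(2) z)
    qed
    also have "\<dots> = (\<integral>\<^sup>+z. ennreal (t / sqrt \<delta> * inner_kernel (\<delta> / t\<^sup>2) z + 32 / t * sqrt \<delta> * outer_kernel (\<delta> / t\<^sup>2) z) \<partial>lborel)
         + (\<integral>\<^sup>+z. ennreal (32 / (t * sqrt \<delta>) * inner_kernel (\<delta> * t\<^sup>2) z + t * sqrt \<delta> * outer_kernel (\<delta> * t\<^sup>2) z) \<partial>lborel)"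
      by (intro nn_integral_add) auto
    also have "\<dots> \<le> ennreal (t / sqrt \<delta> * (16 * pi * sqrt (\<delta> / t\<^sup>2)) + 32 / t * sqrt \<delta> * (32 * pi / sqrt (\<delta> / t\<^sup>2)))
        + ennreal (32 / (t * sqrt \<delta>) * (16 * pi * sqrt (\<delta> * t\<^sup>2)) + t * sqrt \<delta> * (32 * pi / sqrt (\<delta> * t\<^sup>2)))"
      using \<delta> t by (intro add_mono nn_integral_kernels_le) auto
    \<comment> \<open>The thresholds scale so that \<open>t\<close> and \<open>\<delta>\<close>
      cancel, leaving \<open>16 + 32 * 32\<close> here and \<open>32 * 16 + 32\<close> for the other
      pair.\<close>
    also have "t / sqrt \<delta> * (16 * pi * sqrt (\<delta> / t\<^sup>2)) + 32 / t * sqrt \<delta> * (32 * pi / sqrt (\<delta> / t\<^sup>2)) = 1040 * pi"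
      using \<delta> t by (simp add: real_sqrt_divide)
    also have "32 / (t * sqrt \<delta>) * (16 * pi * sqrt (\<delta> * t\<^sup>2)) + t * sqrt \<delta> * (32 * pi / sqrt (\<delta> * t\<^sup>2)) = 544 * pi"
      using \<delta> t by (simp add: real_sqrt_mult)
    also have "ennreal (1040 * pi) + ennreal (544 * pi) = ennreal (1584 * pi)"
      by (subst ennreal_plus[symmetric]) auto
    finally show ?thesis .
  qed
  show ?thesis
  proof (cases "t \<le> 1")
    case True
    have "48 * pi * t \<le> 1584 * pi * min 1 t" using True t by simp
    thus ?thesis using 1 ennreal_leI order_trans by blast
  next
    case False
    thus ?thesis using 2 by simp
  qed
qed

section \<open>Dirichlet energy and test functions of bounded norm\<close>

definition dirichlet_energy :: "(complex \<Rightarrow> complex) \<Rightarrow> ennreal" where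
  "dirichlet_energy f = (\<integral>\<^sup>+z. ennreal ((cmod (deriv f z))\<^sup>2) * indicator (ball 0 1) z \<partial>lborel)"

lemma dirichlet_norm_nonneg: "dirichlet_norm f \<ge> 0"
  unfolding dirichlet_norm_def set_lebesgue_integral_def
  by (intro real_sqrt_ge_zero add_nonneg_nonneg mult_nonneg_nonneg integral_nonneg_AE) auto

text \<open>The energy is an extended integral, so it can be estimated before integrability is
  known; a finite bound then makes the Bochner integral in \<open>dirichlet_norm\<close> genuine.
  The energy carries no factor \<open>1 / pi\<close>, hence the form \<open>pi * K\<close>.\<close>

lemma dirichlet_space_of_energy:
  assumes hol: "f holomorphic_on ball 0 1" and en: "dirichlet_energy f \<le> ennreal (pi * K)" and K: "K \<ge> 0"
  shows "f \<in> dirichlet_space" and "dirichlet_norm f \<le> sqrt ((cmod (f 0))\<^sup>2 + K)"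
proof -
  let ?g = "\<lambda>z. indicator (ball 0 1) z *\<^sub>R (cmod (deriv f z))\<^sup>2"
  have "continuous_on (ball 0 1) (\<lambda>z. (cmod (deriv f z))\<^sup>2)"
    by (intro continuous_intros holomorphic_on_imp_continuous_on holomorphic_deriv hol open_ball)
  hence meas: "?g \<in> borel_measurable borel"
    by (intro borel_measurable_continuous_on_indicator) auto
  have nn: "(\<integral>\<^sup>+z. ennreal (?g z) \<partial>lborel) = dirichlet_energy f"
    unfolding dirichlet_energy_def by (intro nn_integral_cong) (auto simp: indicator_def)
  have int: "integrable lborel ?g"
    using meas en nn by (intro integrableI_nonneg) (auto simp: top.extremum_strict less_top[symmetric] top_unique)
  thus "f \<in> dirichlet_space" using hol by (simp add: dirichlet_space_def set_integrable_def)
  have "ennreal (integral\<^sup>L lborel ?g) = dirichlet_energy f"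
    using nn_integral_eq_integral[OF int] nn by simp
  hence "ennreal (integral\<^sup>L lborel ?g) \<le> ennreal (pi * K)" using en by (simp only:)
  hence "integral\<^sup>L lborel ?g \<le> pi * K" using K by (subst (asm) ennreal_le_iff) simp_all
  thus "dirichlet_norm f \<le> sqrt ((cmod (f 0))\<^sup>2 + K)"
    by (simp add: dirichlet_norm_def set_lebesgue_integral_def field_simps)
qed

lemma dirichlet_energy_le_norm:
  assumes "f \<in> dirichlet_space"
  shows "dirichlet_energy f \<le> ennreal (pi * (dirichlet_norm f)\<^sup>2)"
proof -
  let ?g = "\<lambda>z. indicator (ball 0 1) z *\<^sub>R (cmod (deriv f z))\<^sup>2"
  have int: "integrable lborel ?g" using assms by (simp add: dirichlet_space_def set_integrable_def)
  have "dirichlet_energy f = (\<integral>\<^sup>+z. ennreal (?g z) \<partial>lborel)"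
    unfolding dirichlet_energy_def by (intro nn_integral_cong) (auto simp: indicator_def)
  also have "\<dots> = ennreal (integral\<^sup>L lborel ?g)"
    by (rule nn_integral_eq_integral[OF int]) auto
  also have "integral\<^sup>L lborel ?g \<ge> 0" by (intro integral_nonneg_AE) auto
  hence "integral\<^sup>L lborel ?g \<le> pi * (dirichlet_norm f)\<^sup>2"
    by (simp add: dirichlet_norm_def set_lebesgue_integral_def field_simps)
  hence "ennreal (integral\<^sup>L lborel ?g) \<le> ennreal (pi * (dirichlet_norm f)\<^sup>2)" by (rule ennreal_leI)
  finally show ?thesis .
qed

text \<open>Since \<open>|1 + h - z|\<close> is at least both \<open>h\<close> and
  \<open>|1 - z|\<close>, the squared derivative is dominated by the two kernels at scale
  \<open>h\<close>, whose weighted integrals sum to \<open>48 * pi\<close> for every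
  \<open>h\<close>. With \<open>|f 0| <= 1\<close> this gives \<open>7\<close>, the root of
  \<open>1 + 48\<close>.\<close>

lemma test_function_in_dirichlet_space:
  assumes h: "0 < h" "h \<le> 1"
  defines "f \<equiv> \<lambda>z. of_real h / (1 + of_real h - z) :: complex"
  shows "f \<in> dirichlet_space" and "dirichlet_norm f \<le> 7"
proof -
  have nz: "1 + of_real h - z \<noteq> 0" and ge: "cmod (1 + of_real h - z) \<ge> dist 1 z"
    "cmod (1 + of_real h - z) \<ge> h" if "z \<in> ball 0 1" for z
  proof -
    have "Re z < 1" using that complex_Re_le_cmod[of z] by simp
    have "Re (1 + of_real h - z) > h" using \<open>Re z < 1\<close> by simp
    thus "cmod (1 + of_real h - z) \<ge> h" using complex_Re_le_cmod[of "1 + of_real h - z"] by linarith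
    thus "1 + of_real h - z \<noteq> 0" using h by auto
    show "cmod (1 + of_real h - z) \<ge> dist 1 z"
      using h \<open>Re z < 1\<close> by (auto simp: dist_norm cmod_def intro!: power_mono)
  qed
  have hol: "f holomorphic_on ball 0 1"
    unfolding f_def by (intro holomorphic_intros) (use nz in auto)
  have der: "deriv f z = of_real h / (1 + of_real h - z)\<^sup>2" if "z \<in> ball 0 1" for z
  proof (rule DERIV_imp_deriv)
    show "(f has_field_derivative of_real h / (1 + of_real h - z)\<^sup>2) (at z)"
      unfolding f_def using nz[OF that] by (auto intro!: derivative_eq_intros simp: power2_eq_square)
  qed
  have bd: "(cmod (deriv f z))\<^sup>2 \<le> 1 / sqrt h * inner_kernel h z + sqrt h * outer_kernel h z"
    if z: "z \<in> ball 0 1" for z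
  proof -
    define N where "N = cmod (1 + of_real h - z)"
    define r where "r = dist 1 z"
    have N: "N \<ge> h" "N \<ge> r" "N > 0" using ge[OF z] h unfolding N_def r_def by linarith+
    have r: "r > 0" using disc_quotient(3)[OF z h(1)] by (simp add: r_def)
    have *: "(cmod (deriv f z))\<^sup>2 = h\<^sup>2 / N ^ 4"
      using h by (simp add: der[OF z] norm_divide norm_power N_def power_divide)
    show ?thesis
    proof (cases "r < h")
      case True
      have "h\<^sup>2 / N ^ 4 \<le> h\<^sup>2 / h ^ 4" using N h by (intro divide_left_mono power_mono) auto
      also have "\<dots> = 1 / (sqrt h * (h * sqrt h))" using h by (simp add: field_simps eval_nat_numeral)
      also have "\<dots> \<le> 1 / (sqrt h * (r * sqrt r))"
        using True r h by (intro divide_left_mono mult_left_mono mult_mono) auto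
      finally show ?thesis unfolding * using True by (simp add: inner_kernel_def outer_kernel_def r_def)
    next
      case False
      have "h\<^sup>2 / N ^ 4 \<le> h\<^sup>2 / r ^ 4" using N r by (intro divide_left_mono power_mono) auto
      also have "\<dots> = sqrt h * (h * sqrt h) / (r\<^sup>2 * (r * r))" using h by (simp add: field_simps eval_nat_numeral)
      also have "\<dots> \<le> sqrt h * (r * sqrt r) / (r\<^sup>2 * (r * r))"
        using False r h by (intro divide_right_mono mult_left_mono mult_mono) auto
      also have "\<dots> = sqrt h * (1 / (r\<^sup>2 * sqrt r))"
      proof -
        define A where "A = sqrt r"
        have "r = A * A" "sqrt r = A" "A > 0" using r by (auto simp: A_def)
        thus ?thesis by (simp add: field_simps)
      qed
      finally show ?thesis unfolding * using False by (simp add: inner_kernel_def outer_kernel_def r_def)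
    qed
  qed
  have int: "dirichlet_energy f \<le> ennreal (pi * 48)"
  proof -
    have "dirichlet_energy f \<le> (\<integral>\<^sup>+z. ennreal (1 / sqrt h * inner_kernel h z + sqrt h * outer_kernel h z) \<partial>lborel)"
      unfolding dirichlet_energy_def
      by (intro nn_integral_indicator_mono ennreal_leI bd)
    also have "\<dots> \<le> ennreal (1 / sqrt h * (16 * pi * sqrt h) + sqrt h * (32 * pi / sqrt h))"
      using h by (intro nn_integral_kernels_le) auto
    also have "1 / sqrt h * (16 * pi * sqrt h) + sqrt h * (32 * pi / sqrt h) = pi * 48" using h by simp
    finally show ?thesis .
  qed
  show "f \<in> dirichlet_space"
    by (rule dirichlet_space_of_energy(1)[OF hol int]) simp
  have "f 0 = of_real (h / (1 + h))" by (simp add: f_def)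
  hence "cmod (f 0) = h / (1 + h)" using h by (simp only: norm_of_real) simp
  hence "(cmod (f 0))\<^sup>2 \<le> 1" using h by (simp add: power_le_one)
  hence "sqrt ((cmod (f 0))\<^sup>2 + 48) \<le> sqrt (7\<^sup>2)" by (intro real_sqrt_le_mono) simp
  thus "dirichlet_norm f \<le> 7"
    using dirichlet_space_of_energy(2)[OF hol int] by simp
qed

section \<open>Powers of the map\<close>

text \<open>The scales \<open>d\<close> are arbitrary here: the bounds on powers are uniform in
  them. The total \<open>1 / 2\<close> keeps \<open>Re \<psi>\<close> in the range where
  \<open>1 - \<psi>\<close> stays inside the disc.\<close>

locale bump_series =
  fixes c d :: "nat \<Rightarrow> real"
  assumes c_pos: "\<And>j. c j > 0" and d_pos: "\<And>j. d j > 0"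
    and c_summable: "summable c" and c_suminf: "suminf c \<le> 1 / 2"
begin

definition b :: "nat \<Rightarrow> complex \<Rightarrow> complex" where
  "b j z = bump (of_real (d j) / (1 - z))"

definition b' :: "nat \<Rightarrow> complex \<Rightarrow> complex" where
  "b' j z = (let w = of_real (d j) / (1 - z) in b j z * ((1 - w) / (1 + w)) / (2 * (1 - z)))"

definition \<psi> :: "complex \<Rightarrow> complex" where
  "\<psi> z = (\<Sum>j. of_real (c j) * b j z)"

definition \<psi>' :: "complex \<Rightarrow> complex" where
  "\<psi>' z = (\<Sum>j. of_real (c j) * b' j z)"

definition \<phi> :: "complex \<Rightarrow> complex" where
  "\<phi> z = 1 - \<psi> z"

context
  fixes z :: complex
  assumes z: "z \<in> ball 0 1"
begin

lemmas w_props = disc_quotient(1,2)[OF z d_pos]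

lemma one_minus_nz: "1 - z \<noteq> 0"
  using z by auto

lemma b_has_field_derivative: "(b j has_field_derivative b' j z) (at z)"
proof -
  let ?w = "of_real (d j) / (1 - z)"
  have "((\<lambda>z. of_real (d j) / (1 - z)) has_field_derivative of_real (d j) / (1 - z)\<^sup>2) (at z)"
    using one_minus_nz by (auto intro!: derivative_eq_intros simp: power2_eq_square)
  from DERIV_chain2[OF bump_has_field_derivative[OF w_props(1)[of j]] this]
  have "((\<lambda>z. bump (of_real (d j) / (1 - z))) has_field_derivative
     bump ?w * ((1 - ?w) / (1 + ?w)) / (2 * ?w) * (of_real (d j) / (1 - z)\<^sup>2)) (at z)" .
  moreover have "X / (2 * ?w) * (of_real (d j) / (1 - z)\<^sup>2) = X / (2 * (1 - z))" for X
    using d_pos[of j] one_minus_nz by (simp add: power2_eq_square)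
  ultimately show ?thesis unfolding b_def[abs_def] b'_def Let_def by (simp only:)
qed

text \<open>The Cayley factor in \<open>b'\<close> has norm at most 1 because
  \<open>of_real (d j) / (1 - z)\<close> has positive real part.\<close>

lemma norm_b'_le: "cmod (b' j z) \<le> cmod (b j z) / (2 * dist 1 z)"
proof -
  let ?w = "of_real (d j) / (1 - z)"
  have "cmod ((1 - ?w) / (1 + ?w)) \<le> 1"
    using norm_one_plus_ge(1,3)[OF w_props(1)[of j]] unfolding norm_divide by (intro divide_le_eq_1[THEN iffD2]) auto
  hence "cmod (b j z) * cmod ((1 - ?w) / (1 + ?w)) / (2 * dist 1 z) \<le> cmod (b j z) * 1 / (2 * dist 1 z)"
    by (intro divide_right_mono mult_left_mono) auto
  thus ?thesis
    unfolding b'_def Let_def norm_mult norm_divide dist_norm by simp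
qed

lemma norm_b_le: "cmod (b j z) \<le> 1" "cmod (b j z) \<le> sqrt 2 * Re (b j z)" "Re (b j z) > 0" "Re (b j z) \<le> 1"
proof -
  show 1: "cmod (b j z) \<le> 1"
    unfolding b_def by (rule norm_bump_le_1[OF w_props(1)])
  show "cmod (b j z) \<le> sqrt 2 * Re (b j z)"
    unfolding b_def by (rule norm_le_Re_in_sector[OF bump_in_sector[OF w_props(1)]])
  show "Re (b j z) > 0" unfolding b_def by (rule Re_bump_pos[OF w_props(1)])
  show "Re (b j z) \<le> 1" using 1 complex_Re_le_cmod[of "b j z"] by linarith
qed

end

lemma norm_term_le: "z \<in> ball 0 1 \<Longrightarrow> cmod (of_real (c j) * b j z) \<le> c j"
  using c_pos[of j] norm_b_le(1)[of z j] by (simp add: norm_mult mult_left_le)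

text \<open>The terms are holomorphic and dominated on the disc by the summable \<open>c\<close>, so
  the series may be differentiated termwise. The limits obtained abstractly are then identified with
  \<open>\<psi>\<close> and \<open>\<psi>'\<close>.\<close>

lemma \<psi>_series:
  assumes "z \<in> ball 0 1"
  shows "(\<lambda>j. of_real (c j) * b j z) sums \<psi> z" "(\<lambda>j. of_real (c j) * b' j z) sums \<psi>' z"
    "(\<psi> has_field_derivative \<psi>' z) (at z)"
proof -
  obtain g g' where g: "\<forall>x \<in> ball 0 1. ((\<lambda>j. of_real (c j) * b j x) sums g x) \<and>
      ((\<lambda>j. of_real (c j) * b' j x) sums g' x) \<and> (g has_field_derivative g' x) (at x)"
  proof (rule series_and_derivative_comparison[OF open_ball c_summable])
    show "((\<lambda>z. of_real (c j) * b j z) has_field_derivative of_real (c j) * b' j x) (at x)"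
      if "x \<in> ball 0 1" for j x
      by (rule DERIV_cmult[OF b_has_field_derivative[OF that]])
    show "\<forall>\<^sub>F n in sequentially. \<forall>x\<in>ball 0 1. cmod (of_real (c n) * b n x) \<le> c n"
      by (rule always_eventually) (use norm_term_le in blast)
  qed
  have eq: "\<psi> x = g x" "\<psi>' x = g' x" if "x \<in> ball 0 1" for x
    using g[rule_format, OF that] by (auto simp: \<psi>_def \<psi>'_def sums_iff)
  show "(\<lambda>j. of_real (c j) * b j z) sums \<psi> z" "(\<lambda>j. of_real (c j) * b' j z) sums \<psi>' z"
    using g[rule_format, OF assms] eq[OF assms] by (simp_all only:)
  have "(g has_field_derivative \<psi>' z) (at z)" using g[rule_format, OF assms] eq[OF assms] by (simp only:)
  thus "(\<psi> has_field_derivative \<psi>' z) (at z)"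
    by (rule has_field_derivative_transform_within_open[OF _ open_ball assms]) (simp add: eq)
qed

section \<open>Pointwise estimates for the series and for the powers\<close>

context
  fixes z :: complex
  assumes z: "z \<in> ball 0 1"
begin

lemma Re_\<psi>_sums: "(\<lambda>j. c j * Re (b j z)) sums Re (\<psi> z)"
  using sums_Re[OF \<psi>_series(1)[OF z]] by simp

lemma summable_norm_terms: "summable (\<lambda>j. c j * cmod (b j z))"
  by (rule summable_comparison_test_ev[OF always_eventually c_summable])
    (use norm_term_le[OF z] c_pos in \<open>auto simp: norm_mult abs_mult\<close>)

text \<open>Every term lies in the sector, so even the sum of the norms is controlled by the real
  part of the sum.\<close>

lemma suminf_norm_le_Re: "(\<Sum>j. c j * cmod (b j z)) \<le> sqrt 2 * Re (\<psi> z)"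
proof -
  have "(\<Sum>j. c j * cmod (b j z)) \<le> (\<Sum>j. sqrt 2 * (c j * Re (b j z)))"
  proof (rule suminf_le[OF _ summable_norm_terms])
    show "c j * cmod (b j z) \<le> sqrt 2 * (c j * Re (b j z))" for j
      using mult_left_mono[OF norm_b_le(2)[OF z, of j], of "c j"] c_pos[of j] by (simp add: mult_ac)
    show "summable (\<lambda>j. sqrt 2 * (c j * Re (b j z)))"
      using Re_\<psi>_sums by (intro summable_mult) (auto simp: sums_iff)
  qed
  also have "\<dots> = sqrt 2 * Re (\<psi> z)"
    using sums_mult[OF Re_\<psi>_sums, of "sqrt 2"] by (simp add: sums_iff)
  finally show ?thesis .
qed

lemma Re_\<psi>: "Re (\<psi> z) > 0" "Re (\<psi> z) \<le> 1 / 2"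
proof -
  have s: "summable (\<lambda>j. c j * Re (b j z))" and e: "Re (\<psi> z) = (\<Sum>j. c j * Re (b j z))"
    using Re_\<psi>_sums by (auto simp: sums_iff)
  show "Re (\<psi> z) > 0"
    unfolding e using c_pos norm_b_le(3)[OF z] by (intro suminf_pos s) auto
  have "(\<Sum>j. c j * Re (b j z)) \<le> suminf c"
    using c_pos norm_b_le(4)[OF z] by (intro suminf_le s c_summable) (auto simp: less_imp_le mult_left_le)
  thus "Re (\<psi> z) \<le> 1 / 2" using c_suminf e by simp
qed

lemma norm_\<psi>_le: "cmod (\<psi> z) \<le> sqrt 2 * Re (\<psi> z)"
proof -
  have "cmod (\<psi> z) \<le> (\<Sum>j. c j * cmod (b j z))"
    unfolding \<psi>_def using c_pos
    by (intro norm_suminf_le summable_norm_terms) (simp add: norm_mult less_imp_le)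
  thus ?thesis using suminf_norm_le_Re by linarith
qed

lemma norm_\<psi>'_le: "cmod (\<psi>' z) \<le> sqrt 2 * Re (\<psi> z) / (2 * dist 1 z)"
proof -
  have "cmod (\<psi>' z) \<le> (\<Sum>j. c j * cmod (b j z) / (2 * dist 1 z))"
    unfolding \<psi>'_def
  proof (intro norm_suminf_le summable_divide summable_norm_terms)
    show "cmod (of_real (c j) * b' j z) \<le> c j * cmod (b j z) / (2 * dist 1 z)" for j
      using mult_left_mono[OF norm_b'_le[OF z, of j], of "c j"] c_pos[of j] by (simp add: norm_mult)
  qed
  also have "\<dots> = (\<Sum>j. c j * cmod (b j z)) / (2 * dist 1 z)"
    by (rule suminf_divide[OF summable_norm_terms])
  also have "\<dots> \<le> sqrt 2 * Re (\<psi> z) / (2 * dist 1 z)"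
    by (intro divide_right_mono suminf_norm_le_Re) auto
  finally show ?thesis .
qed

text \<open>With \<open>R = Re (\<psi> z)\<close>, the sector gives
  \<open>|1 - \<psi>|^2 <= 1 - 2 R + 2 R^2\<close>, and \<open>R <= 1 / 2\<close> turns this into
  \<open>1 - R\<close>.\<close>

lemma norm_\<phi>_le: "(cmod (\<phi> z))\<^sup>2 \<le> exp (- Re (\<psi> z))" "cmod (\<phi> z) < 1"
proof -
  have 1: "(cmod (\<phi> z))\<^sup>2 = 1 - 2 * Re (\<psi> z) + (cmod (\<psi> z))\<^sup>2"
    unfolding \<phi>_def cmod_power2 by (simp add: power2_eq_square algebra_simps)
  have "(cmod (\<psi> z))\<^sup>2 \<le> (sqrt 2 * Re (\<psi> z))\<^sup>2"
    by (rule power_mono[OF norm_\<psi>_le]) simp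
  also have "\<dots> = (2 * Re (\<psi> z)) * Re (\<psi> z)" by (simp add: power2_eq_square)
  also have "\<dots> \<le> 1 * Re (\<psi> z)" using Re_\<psi> by (intro mult_right_mono) auto
  finally have 2: "(cmod (\<phi> z))\<^sup>2 \<le> 1 - Re (\<psi> z)" using 1 by linarith
  thus "(cmod (\<phi> z))\<^sup>2 \<le> exp (- Re (\<psi> z))" using exp_ge_add_one_self[of "- Re (\<psi> z)"] by linarith
  have "(cmod (\<phi> z))\<^sup>2 < 1\<^sup>2" using 2 Re_\<psi> by simp
  thus "cmod (\<phi> z) < 1" by (rule power2_less_imp_less) simp
qed

lemma \<phi>_has_field_derivative: "(\<phi> has_field_derivative - \<psi>' z) (at z)"
  unfolding \<phi>_def[abs_def] using \<psi>_series(3)[OF z] by (auto intro!: derivative_eq_intros)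

text \<open>The bounds on \<open>\<psi>'\<close> and \<open>\<phi>\<close> give
  \<open>X^2 * exp (- X) / |1 - z|^2\<close>: having \<open>n - 1\<close> instead of
  \<open>n\<close> factors costs \<open>exp R <= 2\<close>, which is absorbed by the
  \<open>1 / 2\<close> in the squared bound for \<open>\<psi>'\<close>. One factor
  \<open>X * exp (- X / 2)\<close> is then bounded by 1, since a first power of \<open>X\<close> can
  be split over the bumps.\<close>

lemma norm_deriv_power_le:
  assumes n: "n \<ge> 1"
  defines "X \<equiv> real n * Re (\<psi> z)"
  shows "(cmod (deriv (\<lambda>z. \<phi> z ^ n) z))\<^sup>2 \<le> X * exp (- X / 2) / (dist 1 z)\<^sup>2"
proof -
  define R where "R = Re (\<psi> z)"
  define r where "r = dist 1 z"
  have R: "R > 0" "R \<le> 1 / 2" using Re_\<psi> by (auto simp: R_def)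
  have X: "X > 0" using R n by (simp add: X_def R_def)
  have "deriv (\<lambda>z. \<phi> z ^ n) z = of_nat n * (- \<psi>' z * \<phi> z ^ (n - Suc 0))"
    by (intro DERIV_imp_deriv DERIV_power \<phi>_has_field_derivative)
  hence "(cmod (deriv (\<lambda>z. \<phi> z ^ n) z))\<^sup>2 = (real n)\<^sup>2 * (cmod (\<psi>' z))\<^sup>2 * ((cmod (\<phi> z))\<^sup>2) ^ (n - 1)"
    by (simp add: norm_mult norm_power power_mult_distrib mult_ac flip: power_mult)
  also have "\<dots> \<le> (real n)\<^sup>2 * (R\<^sup>2 / (2 * r\<^sup>2)) * (2 * exp (- X))"
  proof (intro mult_mono mult_nonneg_nonneg)
    have "(cmod (\<psi>' z))\<^sup>2 \<le> (sqrt 2 * R / (2 * r))\<^sup>2"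
      using norm_\<psi>'_le by (intro power_mono) (auto simp: R_def r_def)
    thus "(cmod (\<psi>' z))\<^sup>2 \<le> R\<^sup>2 / (2 * r\<^sup>2)" by (simp add: power_mult_distrib power_divide)
    have "((cmod (\<phi> z))\<^sup>2) ^ (n - 1) \<le> exp (- R) ^ (n - 1)"
      using norm_\<phi>_le(1) by (intro power_mono) (auto simp: R_def)
    also have "\<dots> = exp (R + - X)"
      using n by (simp add: X_def R_def of_nat_diff algebra_simps flip: exp_of_nat_mult)
    also have "\<dots> = exp R * exp (- X)" by (rule exp_add)
    also have "exp R \<le> exp (1 / 2)" using R by simp
    hence "exp R \<le> 2" using exp_half_le2 by (rule order_trans)
    hence "exp R * exp (- X) \<le> 2 * exp (- X)" by (intro mult_right_mono) auto
    finally show "((cmod (\<phi> z))\<^sup>2) ^ (n - 1) \<le> 2 * exp (- X)" .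
  qed auto
  also have "\<dots> = (X * exp (- X / 2)) * (X * exp (- X / 2)) / r\<^sup>2"
  proof -
    have "exp (- X) = exp (- X / 2) * exp (- X / 2)" by (simp flip: exp_add)
    thus ?thesis by (simp add: X_def R_def power2_eq_square)
  qed
  also have "\<dots> \<le> 1 * (X * exp (- X / 2)) / r\<^sup>2"
    using mult_exp_le(3)[OF X] X by (intro divide_right_mono mult_right_mono) auto
  finally show ?thesis by (simp add: r_def)
qed

text \<open>With \<open>X = \<Sum>\<^sub>j x\<^sub>j\<close>, the exponent of \<open>X exp (- X / 2)\<close> is weakened to \<open>- x\<^sub>j / 2\<close> in the \<open>j\<close>-th term.\<close>

lemma norm_deriv_power_le_suminf:
  assumes n: "n \<ge> 1"
  defines "x \<equiv> \<lambda>j. (real n * c j) * Re (b j z)"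
  shows "ennreal ((cmod (deriv (\<lambda>z. \<phi> z ^ n) z))\<^sup>2)
    \<le> (\<Sum>j. ennreal (x j * exp (- x j / 2) / (dist 1 z)\<^sup>2))"
proof -
  define X where "X = real n * Re (\<psi> z)"
  have sX: "x sums X"
    using sums_mult[OF Re_\<psi>_sums, of "real n"] unfolding x_def X_def by (simp only: mult.assoc)
  have xp: "x j > 0" for j using n c_pos[of j] norm_b_le(3)[OF z, of j] by (simp add: x_def)
  have xX: "x j \<le> X" for j
    using sum_le_suminf[of x "{j}"] sX xp by (auto simp: sums_iff less_imp_le)
  have sx: "summable (\<lambda>j. x j * exp (- x j / 2))"
  proof (rule summable_comparison_test'[of x 0])
    show "summable x" using sX by (rule sums_summable)
    show "norm (x j * exp (- x j / 2)) \<le> x j" for j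
      using mult_exp_le(1)[OF xp[of j]] xp[of j] unfolding real_norm_def by (subst abs_of_nonneg) auto
  qed
  have "X * exp (- X / 2) = (\<Sum>j. x j * exp (- X / 2))"
    using sums_mult2[OF sX, of "exp (- X / 2)"] by (simp add: sums_iff)
  also have "\<dots> \<le> (\<Sum>j. x j * exp (- x j / 2))"
  proof (rule suminf_le[OF _ summable_mult2[OF sums_summable[OF sX]] sx])
    show "x j * exp (- X / 2) \<le> x j * exp (- x j / 2)" for j
      using xX[of j] xp[of j] by (intro mult_left_mono) auto
  qed
  finally have "X * exp (- X / 2) / (dist 1 z)\<^sup>2 \<le> (\<Sum>j. x j * exp (- x j / 2)) / (dist 1 z)\<^sup>2"
    by (intro divide_right_mono) auto
  also have "\<dots> = (\<Sum>j. x j * exp (- x j / 2) / (dist 1 z)\<^sup>2)"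
    by (rule suminf_divide[OF sx, symmetric])
  finally have "(cmod (deriv (\<lambda>z. \<phi> z ^ n) z))\<^sup>2 \<le> (\<Sum>j. x j * exp (- x j / 2) / (dist 1 z)\<^sup>2)"
    using norm_deriv_power_le[OF n] unfolding X_def by linarith
  hence "ennreal ((cmod (deriv (\<lambda>z. \<phi> z ^ n) z))\<^sup>2) \<le> ennreal (\<Sum>j. x j * exp (- x j / 2) / (dist 1 z)\<^sup>2)"
    by (rule ennreal_leI)
  also have "\<dots> = (\<Sum>j. ennreal (x j * exp (- x j / 2) / (dist 1 z)\<^sup>2))"
    using xp by (intro suminf_ennreal2[symmetric] summable_divide sx) (auto simp: less_imp_le)
  finally show ?thesis .
qed

end

section \<open>Membership in the Dirichlet space and norms of the powers\<close>

lemma \<phi>_holomorphic: "\<phi> holomorphic_on ball 0 1"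
  unfolding holomorphic_on_open[OF open_ball] using \<phi>_has_field_derivative by blast

lemma \<phi>_self_map: "analytic_self_map \<phi>"
  using \<phi>_holomorphic norm_\<phi>_le(2) by (auto simp: analytic_self_map_def)

lemma summable_min: "summable (\<lambda>j. min 1 (real n * c j))"
  by (rule summable_comparison_test'[OF summable_mult[OF c_summable, of "real n"], of 0])
    (use c_pos in \<open>auto simp: less_imp_le\<close>)

text \<open>The pointwise series is integrated term by term; the \<open>j\<close>-th integral is
  \<open>nn_integral_bump_weight_le\<close> with \<open>t = n * c j\<close>, uniformly in
  \<open>d j\<close>.\<close>

lemma energy_power_le:
  assumes n: "n \<ge> 1" and S: "(\<Sum>j. min 1 (real n * c j)) \<le> S"
  shows "dirichlet_energy (\<lambda>z. \<phi> z ^ n) \<le> ennreal (pi * (1584 * S))"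
proof -
  define g where "g = (\<lambda>j z. let x = (real n * c j) * Re (b j z) in x * exp (- x / 2) / (dist 1 z)\<^sup>2)"
  have nc: "real n * c j > 0" for j using n c_pos[of j] by simp
  have meas: "(\<lambda>z. ennreal (g j z) * indicator (ball 0 1) z) \<in> borel_measurable borel" for j
  proof -
    have "b j holomorphic_on ball 0 1"
      unfolding holomorphic_on_open[OF open_ball] using b_has_field_derivative by blast
    hence "continuous_on (ball 0 1) (b j)" by (rule holomorphic_on_imp_continuous_on)
    hence "continuous_on (ball 0 1) (g j)"
      unfolding g_def Let_def by (intro continuous_intros) auto
    hence "(\<lambda>z. indicator (ball 0 1) z *\<^sub>R g j z) \<in> borel_measurable borel"
      by (intro borel_measurable_continuous_on_indicator) auto
    hence "(\<lambda>z. ennreal (indicator (ball 0 1) z *\<^sub>R g j z)) \<in> borel_measurable borel" by measurable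
    moreover have "ennreal (indicator (ball 0 1) z *\<^sub>R g j z) = ennreal (g j z) * indicator (ball 0 1) z" for z
      by (simp add: indicator_def)
    ultimately show ?thesis by (simp only:)
  qed
  have "dirichlet_energy (\<lambda>z. \<phi> z ^ n) \<le> (\<integral>\<^sup>+z. (\<Sum>j. ennreal (g j z) * indicator (ball 0 1) z) \<partial>lborel)"
    unfolding dirichlet_energy_def
  proof (intro nn_integral_mono)
    fix z :: complex
    show "ennreal ((cmod (deriv (\<lambda>z. \<phi> z ^ n) z))\<^sup>2) * indicator (ball 0 1) z
      \<le> (\<Sum>j. ennreal (g j z) * indicator (ball 0 1) z)"
    proof (cases "z \<in> ball 0 1")
      case True
      show ?thesis using norm_deriv_power_le_suminf[OF True n] True by (simp add: g_def Let_def)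
    qed simp
  qed
  also have "\<dots> = (\<Sum>j. \<integral>\<^sup>+z. ennreal (g j z) * indicator (ball 0 1) z \<partial>lborel)"
    using meas by (intro nn_integral_suminf) simp
  also have "\<dots> \<le> (\<Sum>j. ennreal (1584 * pi * min 1 (real n * c j)))"
  proof (intro suminf_le summableI)
    show "(\<integral>\<^sup>+z. ennreal (g j z) * indicator (ball 0 1) z \<partial>lborel)
      \<le> ennreal (1584 * pi * min 1 (real n * c j))" for j
      using nn_integral_bump_weight_le[OF d_pos nc] unfolding g_def Let_def b_def .
  qed
  also have "\<dots> = ennreal (\<Sum>j. 1584 * pi * min 1 (real n * c j))"
  proof (rule suminf_ennreal2)
    show "1584 * pi * min 1 (real n * c j) \<ge> 0" for j using nc[of j] by simp
    show "summable (\<lambda>j. 1584 * pi * min 1 (real n * c j))" by (intro summable_mult summable_min)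
  qed
  also have "\<dots> \<le> ennreal (pi * (1584 * S))"
  proof (rule ennreal_leI)
    have "(\<Sum>j. 1584 * pi * min 1 (real n * c j)) = 1584 * pi * (\<Sum>j. min 1 (real n * c j))"
      by (rule suminf_mult[OF summable_min])
    also have "\<dots> \<le> 1584 * pi * S" using S by (intro mult_left_mono) auto
    finally show "(\<Sum>j. 1584 * pi * min 1 (real n * c j)) \<le> pi * (1584 * S)" by (simp add: mult_ac)
  qed
  finally show ?thesis .
qed

lemma \<phi>_in_dirichlet_space: "\<phi> \<in> dirichlet_space"
proof (rule dirichlet_space_of_energy(1)[OF \<phi>_holomorphic])
  let ?S = "\<Sum>j. min 1 (real 1 * c j)"
  show "dirichlet_energy \<phi> \<le> ennreal (pi * (1584 * ?S))"
    using energy_power_le[of 1 ?S] by simp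
  show "1584 * ?S \<ge> 0"
    using c_pos by (intro mult_nonneg_nonneg suminf_nonneg summable_min) (auto simp: less_imp_le)
qed

lemma dirichlet_norm_power_le:
  assumes n: "n \<ge> 1" and S: "(\<Sum>j. min 1 (real n * c j)) \<le> S" "S \<ge> 0"
  shows "dirichlet_norm (\<lambda>z. \<phi> z ^ n) \<le> sqrt (1 + 1584 * S)"
proof -
  have "(\<lambda>z. \<phi> z ^ n) holomorphic_on ball 0 1"
    using \<phi>_holomorphic by (intro holomorphic_intros)
  from dirichlet_space_of_energy(2)[OF this energy_power_le[OF n S(1)]] S(2)
  have "dirichlet_norm (\<lambda>z. \<phi> z ^ n) \<le> sqrt ((cmod (\<phi> 0 ^ n))\<^sup>2 + 1584 * S)" by simp
  also have "\<dots> \<le> sqrt (1 + 1584 * S)"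
    using norm_\<phi>_le(2)[of 0] by (simp add: norm_power power_le_one)
  finally show ?thesis .
qed

end

section \<open>Unboundedness of the composition operator\<close>

text \<open>Consecutive scales are so far apart that, at the scale \<open>d j\<close>, every other
  bump is small even relative to \<open>c j\<close>; monotonicity of \<open>c\<close> converts
  smallness relative to a later \<open>c i\<close>. The bound on \<open>d\<close> places the discs
  \<open>B j\<close> in the unit disc.\<close>

locale separated_bump_series = bump_series +
  assumes antimono_c: "antimono c" and d_le_1: "\<And>j. d j \<le> 1"
    and d_separated: "\<And>i j. j < i \<Longrightarrow> sqrt (d i) \<le> sqrt (d j) * (c i / 160)"
begin

lemma c_le_half: "c j \<le> 1 / 2"
proof -
  have "c j \<le> suminf c" using sum_le_suminf[OF c_summable, of "{j}"] c_pos by (simp add: less_imp_le)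
  thus ?thesis using c_suminf by linarith
qed

lemma d_less: "j < i \<Longrightarrow> d i \<le> d j / 4"
proof -
  assume "j < i"
  have "sqrt (d j) * (c i / 160) \<le> sqrt (d j) * (1 / 2)"
    using c_le_half[of i] d_pos[of j] by (intro mult_left_mono) auto
  hence "sqrt (d i) \<le> sqrt (d j) * (1 / 2)" using d_separated[OF \<open>j < i\<close>] by linarith
  hence "(sqrt (d i))\<^sup>2 \<le> (sqrt (d j) * (1 / 2))\<^sup>2" using d_pos[of i] by (intro power_mono) auto
  thus ?thesis using d_pos[of i] d_pos[of j] by (simp add: power_mult_distrib power2_eq_square)
qed

text \<open>The centre avoids \<open>1 - d\<^sub>j\<close>, where the derivative of the \<open>j\<close>-th bump vanishes.\<close>

definition B :: "nat \<Rightarrow> complex set" where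
  "B j = ball (of_real (1 - d j / 4)) (d j / 8)"

context
  fixes z :: complex and j :: nat
  assumes zB: "z \<in> B j"
begin

lemma dist_B: "dist 1 z > d j / 8" "dist 1 z < 3 * d j / 8"
proof -
  have 1: "dist (of_real (1 - d j / 4)) z < d j / 8" using zB by (simp add: B_def)
  have 2: "dist 1 (of_real (1 - d j / 4) :: complex) = d j / 4"
  proof -
    have "1 - of_real (1 - d j / 4) = (of_real (d j / 4) :: complex)" by simp
    thus ?thesis using d_pos[of j] unfolding dist_norm by (simp only: norm_of_real)
  qed
  show "dist 1 z > d j / 8" "dist 1 z < 3 * d j / 8"
    using 1 2 dist_triangle[of 1 z "of_real (1 - d j / 4)"]
      dist_triangle2[of 1 "of_real (1 - d j / 4)" z]
    by linarith+
qed

lemma z_disc: "z \<in> ball 0 1"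
proof -
  have "cmod z \<le> cmod (of_real (1 - d j / 4)) + dist (of_real (1 - d j / 4)) z"
    by (metis dist_norm dist_commute norm_triangle_sub)
  moreover have "cmod (of_real (1 - d j / 4)) = 1 - d j / 4"
    unfolding norm_of_real using d_le_1[of j] by simp
  moreover have "dist (of_real (1 - d j / 4)) z < d j / 8" using zB by (simp add: B_def)
  ultimately show ?thesis using d_pos[of j] by simp
qed

text \<open>For \<open>i < j\<close> the point is far inside the scale of the bump and
  \<open>sqrt (r / d i)\<close> is small; for \<open>i > j\<close> it is far outside and
  \<open>sqrt (d i / r)\<close> is small. The losses \<open>1 / 160\<close> and
  \<open>3 / 160\<close> both fit under \<open>1 / 50\<close>.\<close>

lemma norm_b_other:
  assumes "i \<noteq> j"
  shows "cmod (b i z) \<le> c j / 50"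
proof -
  note w = disc_quotient(1,2)[OF z_disc d_pos[of i]]
  define r where "r = dist 1 z"
  have r: "r > d j / 8" "r < 3 * d j / 8" "r > 0" using dist_B d_pos[of j] unfolding r_def by linarith+
  have sd: "sqrt (d i) > 0" "sqrt (d j) > 0" using d_pos by auto
  have le: "cmod (b i z) \<le> sqrt (d i) / sqrt r" "cmod (b i z) \<le> sqrt r / sqrt (d i)"
    using norm_bump_le[OF w(1)] unfolding w(2) b_def by (simp_all add: real_sqrt_divide r_def)
  show ?thesis
  proof (cases "i < j")
    case True
    have "sqrt r / sqrt (d i) \<le> sqrt (d j) / sqrt (d i)"
      using r d_pos[of j] sd by (intro divide_right_mono real_sqrt_le_mono) auto
    also have "\<dots> \<le> sqrt (d i) * (c j / 160) / sqrt (d i)"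
      using d_separated[OF True] sd by (intro divide_right_mono) auto
    also have "\<dots> = c j / 160" using sd by simp
    finally show ?thesis using le(2) c_pos[of j] by linarith
  next
    case False
    hence ji: "j < i" using assms by simp
    \<comment> \<open>The available \<open>d j < 8 * r\<close> is relaxed to \<open>9 * r\<close>
      for the sake of a rational root.\<close>
    have "sqrt (d j) \<le> sqrt (9 * r)" using r by (intro real_sqrt_le_mono) auto
    also have "\<dots> = 3 * sqrt r" by (simp add: real_sqrt_mult)
    finally have "sqrt (d j) / 3 \<le> sqrt r" by simp
    hence "sqrt (d i) / sqrt r \<le> sqrt (d i) / (sqrt (d j) / 3)"
      using sd r by (intro divide_left_mono mult_pos_pos) auto
    also have "\<dots> \<le> sqrt (d j) * (c i / 160) / (sqrt (d j) / 3)"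
      using d_separated[OF ji] sd by (intro divide_right_mono) auto
    also have "\<dots> = 3 * c i / 160" using sd by simp
    finally have "cmod (b i z) \<le> 3 * c i / 160" using le(1) by linarith
    moreover have "c i \<le> c j" using antimonoD[OF antimono_c, of j i] ji by simp
    ultimately show ?thesis using c_pos[of j] by linarith
  qed
qed

text \<open>The coefficients sum to at most \<open>1 / 2\<close>, so a uniform bound on the other
  terms is halved. The general \<open>f\<close> covers both \<open>b\<close> and
  \<open>b'\<close>.\<close>

lemma norm_remainder_le:
  assumes s: "(\<lambda>i. of_real (c i) * f i) sums (S :: complex)"
    and le: "\<And>i. i \<noteq> j \<Longrightarrow> cmod (f i) \<le> e" and e: "e \<ge> 0"
  shows "cmod (S - of_real (c j) * f j) \<le> e / 2"
proof -
  let ?g = "\<lambda>i. of_real (c i) * f i - (if i = j then of_real (c i) * f i else 0)"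
  have "?g sums (S - of_real (c j) * f j)"
    using sums_diff[OF s sums_single[of j "\<lambda>i. of_real (c i) * f i"]] .
  hence "S - of_real (c j) * f j = suminf ?g" by (simp add: sums_iff)
  also have "cmod (suminf ?g) \<le> (\<Sum>i. c i * e)"
  proof (rule norm_suminf_le)
    show "cmod (?g i) \<le> c i * e" for i
      using le[of i] c_pos[of i] e by (auto simp: norm_mult intro: mult_left_mono)
  qed (rule summable_mult2[OF c_summable])
  also have "\<dots> = suminf c * e" by (rule suminf_mult2[OF c_summable, symmetric])
  also have "\<dots> \<le> 1 / 2 * e" using e c_suminf by (intro mult_right_mono) auto
  finally show ?thesis by simp
qed

lemma norm_\<psi>_B: "cmod (\<psi> z) \<le> 2 * c j"
proof -
  have "cmod (\<psi> z - of_real (c j) * b j z) \<le> c j / 50 / 2"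
    using c_pos[of j] by (intro norm_remainder_le \<psi>_series(1) z_disc norm_b_other) auto
  moreover have "cmod (\<psi> z) \<le> cmod (\<psi> z - of_real (c j) * b j z) + cmod (of_real (c j) * b j z)"
    by (metis norm_triangle_ineq diff_add_cancel)
  ultimately show ?thesis using norm_term_le[OF z_disc, of j] c_pos[of j] by linarith
qed

text \<open>On \<open>B j\<close> the quotient \<open>w\<close> stays away from 1, so the Cayley
  factor, and with it the \<open>j\<close>-th derivative, is bounded below; the other terms are too
  small to cancel it.\<close>

lemma norm_\<psi>'_B: "cmod (\<psi>' z) \<ge> c j / (15 * d j)"
proof -
  define r where "r = dist 1 z"
  have r: "r > d j / 8" "r < 3 * d j / 8" "r > 0" using dist_B d_pos[of j] unfolding r_def by linarith+
  have "cmod (\<psi>' z - of_real (c j) * b' j z) \<le> c j / 50 / (2 * r) / 2"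
  proof (intro norm_remainder_le \<psi>_series(2) z_disc)
    fix i assume "i \<noteq> j"
    have "cmod (b i z) / (2 * r) \<le> c j / 50 / (2 * r)"
      using r by (intro divide_right_mono norm_b_other \<open>i \<noteq> j\<close>) auto
    thus "cmod (b' i z) \<le> c j / 50 / (2 * r)" using norm_b'_le[OF z_disc, of i] unfolding r_def by linarith
  qed (use c_pos[of j] r in simp)
  hence 1: "cmod (\<psi>' z - of_real (c j) * b' j z) \<le> c j / r * (1 / 200)" by simp
  define w where "w = of_real (d j) / (1 - z)"
  note ww = disc_quotient(1,2)[OF z_disc d_pos[of j], folded w_def]
  have wr: "cmod w = d j / r" using ww(2) by (simp add: r_def)
  \<comment> \<open>The upper bound 8 is relaxed to \<open>9 = 3^2\<close> to get a rational
    root.\<close>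
  have w: "cmod w \<ge> 8 / 3" "cmod w \<le> 9" using r unfolding wr by (auto simp: field_simps)
  have "sqrt (cmod w) \<le> sqrt (3\<^sup>2)" using w by (intro real_sqrt_le_mono) simp
  hence s: "sqrt (cmod w) \<le> 3" "sqrt (cmod w) \<ge> 1" using w by auto
  have "1 / 3 \<le> min (sqrt (cmod w)) (1 / sqrt (cmod w))"
  proof (rule min.boundedI)
    show "1 / 3 \<le> sqrt (cmod w)" using s(2) by linarith
    have "sqrt (cmod w) > 0" using s(2) by linarith
    thus "1 / 3 \<le> 1 / sqrt (cmod w)" using s(1) by (intro divide_left_mono) auto
  qed
  hence "1 / 3 / 2 \<le> min (sqrt (cmod w)) (1 / sqrt (cmod w)) / 2" by (rule divide_right_mono) simp
  also have "\<dots> \<le> cmod (b j z)" using norm_bump_ge[OF ww(1)] unfolding b_def w_def[symmetric] .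
  finally have b: "cmod (b j z) \<ge> 1 / 6" by simp
  have "5 / 11 \<le> (cmod w - 1) / (cmod w + 1)" using w by (simp add: field_simps)
  also have "\<dots> \<le> cmod (1 - w) / cmod (1 + w)"
  proof (rule frac_le)
    show "cmod w - 1 \<le> cmod (1 - w)" using norm_triangle_ineq2[of w 1] by (simp add: norm_minus_commute)
    show "cmod (1 + w) \<le> cmod w + 1" using norm_triangle_ineq[of 1 w] by simp
    show "0 < cmod (1 + w)" using norm_one_plus_ge(1)[OF ww(1)] by linarith
  qed simp
  finally have q: "5 / 11 \<le> cmod (1 - w) / cmod (1 + w)" .
  have "cmod (b' j z) = cmod (b j z) * (cmod (1 - w) / cmod (1 + w)) / (2 * r)"
    unfolding b'_def Let_def w_def[symmetric] norm_mult norm_divide r_def dist_norm by simp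
  moreover have "1 / 6 * (5 / 11) / (2 * r) \<le> cmod (b j z) * (cmod (1 - w) / cmod (1 + w)) / (2 * r)"
    using b q r by (intro divide_right_mono mult_mono) auto
  ultimately have "cmod (b' j z) \<ge> 5 / (132 * r)" by simp
  hence "c j * cmod (b' j z) \<ge> c j * (5 / (132 * r))" using c_pos[of j] by (intro mult_left_mono) auto
  hence 2: "cmod (of_real (c j) * b' j z) \<ge> c j / r * (5 / 132)" using c_pos[of j] by (simp add: norm_mult)
  have "cmod (of_real (c j) * b' j z) \<le> cmod (\<psi>' z) + cmod (\<psi>' z - of_real (c j) * b' j z)"
    by (metis norm_triangle_sub norm_minus_commute)
  moreover define Q where "Q = c j / r"
  moreover have "0 < Q" using r c_pos[of j] by (simp add: Q_def)
  \<comment> \<open>The main term has at least \<open>5 / 132\<close> of \<open>Q\<close>, the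
    remainder at most \<open>1 / 200\<close>, and the difference exceeds
    \<open>1 / 40\<close>.\<close>
  ultimately have "Q * (1 / 40) \<le> cmod (\<psi>' z)" using 1 2 unfolding Q_def[symmetric] by linarith
  moreover have "c j / (3 * d j / 8) \<le> Q"
    unfolding Q_def using r c_pos[of j] d_pos[of j] by (intro divide_left_mono) auto
  from mult_right_mono[OF this, of "1 / 40"] have "c j / (3 * d j / 8) * (1 / 40) \<le> Q * (1 / 40)" by simp
  ultimately have "c j / (3 * d j / 8) * (1 / 40) \<le> cmod (\<psi>' z)" by (rule order_trans[rotated])
  thus ?thesis by simp
qed

end

text \<open>\<open>B j\<close> lies in the annulus \<open>d j / 8 < |1 - z| < 3 * d j / 8\<close>,
  and a later scale is at most a quarter of an earlier one: \<open>3 / 32 < 1 / 8\<close>.\<close>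

lemma B_disjoint:
  assumes "z \<in> B i" "z \<in> B j"
  shows "i = j"
proof (rule ccontr)
  assume "i \<noteq> j"
  then consider "i < j" | "j < i" by linarith
  thus False
    by cases (use d_less[of i j] d_less[of j i] dist_B[OF assms(1)] dist_B[OF assms(2)]
        d_pos[of i] d_pos[of j] in linarith)+
qed

text \<open>With \<open>h = c j\<close> the composition is \<open>h / (h + \<psi>)\<close>. On
  \<open>B j\<close> the denominator has norm at most \<open>3 * c j\<close> and
  \<open>|\<psi>'|\<close> is at least a multiple of \<open>c j / d j\<close>, so all powers of
  \<open>c j\<close> cancel.\<close>

lemma norm_deriv_test_ge:
  assumes z: "z \<in> B j"
  shows "(cmod (deriv ((\<lambda>z. of_real (c j) / (1 + of_real (c j) - z)) \<circ> \<phi>) z))\<^sup>2 \<ge> 1 / (135 * d j)\<^sup>2"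
proof -
  let ?h = "of_real (c j) :: complex"
  have zD: "z \<in> ball 0 1" by (rule z_disc[OF z])
  have eq: "(\<lambda>z. ?h / (1 + ?h - z)) \<circ> \<phi> = (\<lambda>z. ?h / (?h + \<psi> z))"
    by (auto simp: \<phi>_def)
  have "Re (?h + \<psi> z) > 0" using Re_\<psi>[OF zD] c_pos[of j] by simp
  hence nz: "?h + \<psi> z \<noteq> 0" by (metis less_irrefl zero_complex.sel(1))
  have "((\<lambda>z. ?h / (?h + \<psi> z)) has_field_derivative - (?h * \<psi>' z) / (?h + \<psi> z)\<^sup>2) (at z)"
    using nz \<psi>_series(3)[OF zD] by (auto intro!: derivative_eq_intros simp: power2_eq_square)
  hence "cmod (deriv ((\<lambda>z. ?h / (1 + ?h - z)) \<circ> \<phi>) z) = c j * cmod (\<psi>' z) / (cmod (?h + \<psi> z))\<^sup>2"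
    using c_pos[of j] by (simp add: eq DERIV_imp_deriv norm_divide norm_mult norm_power)
  also have "\<dots> \<ge> c j * (c j / (15 * d j)) / (3 * c j)\<^sup>2"
  proof (intro frac_le mult_left_mono power_mono)
    show "cmod (?h + \<psi> z) \<le> 3 * c j"
      using norm_triangle_ineq[of ?h "\<psi> z"] norm_\<psi>_B[OF z] c_pos[of j] by simp
  qed (use norm_\<psi>'_B[OF z] c_pos[of j] nz in auto)
  hence "1 / (135 * d j) \<le> c j * cmod (\<psi>' z) / (cmod (?h + \<psi> z))\<^sup>2"
    using c_pos[of j] by (simp add: power2_eq_square)
  finally have "(1 / (135 * d j))\<^sup>2 \<le> (cmod (deriv ((\<lambda>z. ?h / (1 + ?h - z)) \<circ> \<phi>) z))\<^sup>2"
    using d_pos[of j] by (intro power_mono) auto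
  thus ?thesis by (simp add: power_divide)
qed

text \<open>Each \<open>B j\<close> has area \<open>pi * (d j / 8)^2\<close>, which cancels the
  scale in the derivative bound and contributes the fixed amount \<open>pi / (135 * 8)^2\<close>.
  Disjointness lets these contributions add.\<close>

lemma energy_test_ge:
  assumes J: "finite J" "\<And>j. j \<in> J \<Longrightarrow> c j = h"
  shows "dirichlet_energy ((\<lambda>z. of_real h / (1 + of_real h - z)) \<circ> \<phi>) \<ge> ennreal (pi * (real (card J) / 1166400))"
proof -
  let ?f = "(\<lambda>z. of_real h / (1 + of_real h - z)) \<circ> \<phi>"
  have "ennreal (pi * (real (card J) / 1166400)) = (\<Sum>j\<in>J. ennreal (pi / 1166400))"
    by (simp add: ennreal_of_nat_eq_real_of_nat ennreal_mult[symmetric] mult_ac)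
  also have "\<dots> = (\<Sum>j\<in>J. \<integral>\<^sup>+z. ennreal (1 / (135 * d j)\<^sup>2) * indicator (B j) z \<partial>lborel)"
  proof (rule sum.cong[OF refl])
    fix j
    have "(\<integral>\<^sup>+z. ennreal (1 / (135 * d j)\<^sup>2) * indicator (B j) z \<partial>lborel)
      = ennreal (1 / (135 * d j)\<^sup>2) * ennreal (pi * (d j / 8)\<^sup>2)"
      using d_pos[of j] unfolding B_def
      by (subst nn_integral_cmult_indicator) (simp_all add: emeasure_ball unit_ball_vol_2)
    also have "\<dots> = ennreal (1 / (135 * d j)\<^sup>2 * (pi * (d j / 8)\<^sup>2))"
      by (rule ennreal_mult[symmetric]) auto
    also have "1 / (135 * d j)\<^sup>2 * (pi * (d j / 8)\<^sup>2) = pi / 1166400"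
      using d_pos[of j] by (simp add: power2_eq_square)
    finally show "ennreal (pi / 1166400) = (\<integral>\<^sup>+z. ennreal (1 / (135 * d j)\<^sup>2) * indicator (B j) z \<partial>lborel)" ..
  qed
  also have "\<dots> = (\<integral>\<^sup>+z. (\<Sum>j\<in>J. ennreal (1 / (135 * d j)\<^sup>2) * indicator (B j) z) \<partial>lborel)"
    by (intro nn_integral_sum[symmetric] borel_measurable_times_ennreal borel_measurable_indicator)
      (auto simp: B_def)
  also have "\<dots> \<le> dirichlet_energy ?f"
    unfolding dirichlet_energy_def
  proof (intro nn_integral_mono)
    fix z :: complex
    show "(\<Sum>j\<in>J. ennreal (1 / (135 * d j)\<^sup>2) * indicator (B j) z)
      \<le> ennreal ((cmod (deriv ?f z))\<^sup>2) * indicator (ball 0 1) z"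
    proof (cases "\<exists>j\<in>J. z \<in> B j")
      case False
      hence "(\<Sum>j\<in>J. ennreal (1 / (135 * d j)\<^sup>2) * indicator (B j) z) = 0"
        by (intro sum.neutral) auto
      thus ?thesis by simp
    next
      case True
      then obtain j where j: "j \<in> J" "z \<in> B j" by blast
      have "(\<Sum>i\<in>J. ennreal (1 / (135 * d i)\<^sup>2) * indicator (B i) z)
          = (\<Sum>i\<in>{j}. ennreal (1 / (135 * d i)\<^sup>2) * indicator (B i) z)"
      proof (rule sum.mono_neutral_right[OF J(1)])
        have "z \<notin> B i" if "i \<in> J - {j}" for i using B_disjoint[OF j(2), of i] that by blast
        thus "\<forall>i\<in>J - {j}. ennreal (1 / (135 * d i)\<^sup>2) * indicator (B i) z = 0" by simp
      qed (use j in simp)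
      also have "\<dots> = ennreal (1 / (135 * d j)\<^sup>2)" using j by simp
      also have "\<dots> \<le> ennreal ((cmod (deriv ?f z))\<^sup>2)"
        using norm_deriv_test_ge[OF j(2)] unfolding J(2)[OF j(1)] by (rule ennreal_leI)
      finally show ?thesis using z_disc[OF j(2)] by simp
    qed
  qed
  finally show ?thesis .
qed

text \<open>A block of equal coefficients \<open>h\<close> makes one test function of norm at most 7
  gain energy proportional to the block size, which exceeds any bound an operator constant
  allows.\<close>

lemma not_dirichlet_symbol:
  assumes blocks: "\<And>K. \<exists>J h. finite J \<and> card J \<ge> K \<and> (\<forall>j\<in>J. c j = h)"
  shows "\<not> dirichlet_symbol \<phi>"
proof
  assume "dirichlet_symbol \<phi>"
  then obtain C where
    mem: "\<And>f. f \<in> dirichlet_space \<Longrightarrow> f \<circ> \<phi> \<in> dirichlet_space" and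
    C: "\<And>f. f \<in> dirichlet_space \<Longrightarrow> dirichlet_norm (f \<circ> \<phi>) \<le> C * dirichlet_norm f"
    unfolding dirichlet_symbol_def by blast
  \<comment> \<open>Chosen so that a block of this size contradicts the bound
    \<open>(\<bar>C\<bar> * 7)^2\<close> after division by the contribution of one disc; the
    absolute value allows for a negative \<open>C\<close>.\<close>
  define K where "K = Suc (nat \<lceil>1166400 * (\<bar>C\<bar> * 7)\<^sup>2\<rceil>)"
  obtain J h where J: "finite J" "card J \<ge> K" "\<forall>j\<in>J. c j = h" using blocks by blast
  have "K > 0" by (simp add: K_def)
  hence "J \<noteq> {}" using J by auto
  then obtain j where "j \<in> J" by blast
  hence h: "0 < h" "h \<le> 1" using J(3) c_pos[of j] c_le_half[of j] by auto
  let ?f = "\<lambda>z. of_real h / (1 + of_real h - z) :: complex"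
  have f: "?f \<in> dirichlet_space" "dirichlet_norm ?f \<le> 7" by (rule test_function_in_dirichlet_space[OF h])+
  have "dirichlet_norm (?f \<circ> \<phi>) \<le> C * dirichlet_norm ?f" by (rule C[OF f(1)])
  also have "\<dots> \<le> \<bar>C\<bar> * 7" using f(2) dirichlet_norm_nonneg by (intro mult_mono) auto
  finally have *: "dirichlet_norm (?f \<circ> \<phi>) \<le> \<bar>C\<bar> * 7" .
  have "ennreal (pi * (real (card J) / 1166400)) \<le> dirichlet_energy (?f \<circ> \<phi>)"
    using J by (intro energy_test_ge) auto
  also have "\<dots> \<le> ennreal (pi * (dirichlet_norm (?f \<circ> \<phi>))\<^sup>2)"
    by (rule dirichlet_energy_le_norm[OF mem[OF f(1)]])
  also have "\<dots> \<le> ennreal (pi * (\<bar>C\<bar> * 7)\<^sup>2)"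
    using * dirichlet_norm_nonneg by (intro ennreal_leI mult_left_mono power_mono) auto
  finally have "pi * (real (card J) / 1166400) \<le> pi * (\<bar>C\<bar> * 7)\<^sup>2"
    by (subst (asm) ennreal_le_iff) auto
  hence "real (card J) \<le> 1166400 * (\<bar>C\<bar> * 7)\<^sup>2" by simp
  moreover have "1166400 * (\<bar>C\<bar> * 7)\<^sup>2 < real K" unfolding K_def by linarith
  ultimately show False using J(2) by linarith
qed

end

section \<open>Choice of the coefficients and scales\<close>

text \<open>The coefficients are constant on dyadic blocks of \<open>2 ^ k\<close> indices. Index
  \<open>j\<close> of block \<open>k\<close> is charged \<open>v j = 4^(-k)\<close>, still summable
  over all blocks, and \<open>c\<close> is made so small on block \<open>k\<close> that
  \<open>min 1 (n * c j)\<close> exceeds \<open>v j\<close> only once \<open>M n >= 2 ^ k\<close>,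
  when \<open>v j * (M n)^2\<close> is already at least 1.\<close>

lemma exists_block_coefficients:
  fixes M :: "nat \<Rightarrow> real"
  assumes M: "filterlim M at_top sequentially"
  obtains c :: "nat \<Rightarrow> real" and W :: real
  where "\<And>j. c j > 0" "antimono c" "summable c" "suminf c \<le> 1 / 2" "W \<ge> 0"
    "\<And>n. (\<Sum>j. min 1 (real n * c j)) \<le> W * ((M n)\<^sup>2 + 1)"
    "\<And>K. \<exists>J h. finite J \<and> card J \<ge> K \<and> (\<forall>j\<in>J. c j = h)"
proof -
  have "\<exists>N. \<forall>n\<ge>N. 2 ^ k \<le> M n" for k
    using M unfolding filterlim_at_top eventually_sequentially by blast
  then obtain N where N: "\<And>k n. n \<ge> N k \<Longrightarrow> 2 ^ k \<le> M n" by metis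
  \<comment> \<open>The block of \<open>j\<close> is the set of indices with the same binary
    logarithm of \<open>j + 1\<close>; the shift admits \<open>j = 0\<close>.\<close>
  define \<kappa> where "\<kappa> = (\<lambda>j. floor_log (Suc j))"
  define v where "v = (\<lambda>j. 1 / 4 ^ \<kappa> j :: real)"
  have v_pos: "v j > 0" for j by (simp add: v_def)
  have v_le: "v j \<le> 4 * (1 / (real (Suc j))\<^sup>2)" for j
  proof -
    have "real (Suc j) \<le> 2 * 2 ^ \<kappa> j"
      unfolding \<kappa>_def using floor_log_exp2_ge[of "Suc j"]
      by (metis of_nat_le_iff of_nat_mult of_nat_numeral of_nat_power)
    hence "(real (Suc j))\<^sup>2 \<le> (2 * 2 ^ \<kappa> j)\<^sup>2" by (rule power_mono) simp
    also have "\<dots> = 4 * 4 ^ \<kappa> j" by (simp add: power2_eq_square flip: power_mult_distrib)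
    finally show ?thesis unfolding v_def by (simp add: field_simps del: of_nat_Suc)
  qed
  have v_summable: "summable v"
  proof (rule summable_comparison_test'[of "\<lambda>j. 4 * (1 / (real (Suc j))\<^sup>2)" 0])
    show "summable (\<lambda>j. 4 * (1 / (real (Suc j))\<^sup>2))"
      using inverse_squares_sums by (intro summable_mult) (auto simp: sums_iff)
    show "norm (v j) \<le> 4 * (1 / (real (Suc j))\<^sup>2)" for j
      using v_le[of j] v_pos[of j] by simp
  qed
  define W where "W = suminf v"
  have W: "W \<ge> 0" unfolding W_def using v_pos by (intro suminf_nonneg v_summable) (simp add: less_imp_le)
  \<comment> \<open>Partial sums dominate each threshold \<open>N k\<close> and are monotone in
    \<open>k\<close>, as needed for \<open>antimono c\<close>; the \<open>1\<close> keeps them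
    positive.\<close>
  define T where "T = (\<lambda>k. 1 + real (\<Sum>i\<le>k. N i))"
  have T_mono: "T k \<le> T l" if "k \<le> l" for k l
    unfolding T_def using that by (auto intro!: sum_mono2 simp del: of_nat_sum)
  have T_ge: "T k \<ge> 1" "T k \<ge> real (N k)" for k
  proof -
    have "N k \<le> (\<Sum>i\<le>k. N i)" by (rule member_le_sum) auto
    thus "T k \<ge> real (N k)" "T k \<ge> 1" unfolding T_def by linarith+
  qed
  \<comment> \<open>The factor \<open>2 * (1 + W)\<close> brings the total down to
    \<open>W / (2 * (1 + W))\<close>, below \<open>1 / 2\<close>.\<close>
  define c where "c = (\<lambda>j. v j / (2 * (1 + W) * T (\<kappa> j)))"
  have T_pos: "T k > 0" for k using T_ge(1)[of k] by linarith
  have c_pos: "c j > 0" for j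
    unfolding c_def using v_pos W T_pos by (intro divide_pos_pos mult_pos_pos) auto
  have c_le: "c j \<le> v j / (2 * (1 + W))" for j
  proof -
    have "2 * (1 + W) * 1 \<le> 2 * (1 + W) * T (\<kappa> j)" using W T_ge by (intro mult_left_mono) auto
    thus ?thesis unfolding c_def using W v_pos[of j] T_pos[of "\<kappa> j"]
      by (intro divide_left_mono mult_pos_pos) auto
  qed
  have vW: "(\<lambda>j. v j / (2 * (1 + W))) sums (W / (2 * (1 + W)))"
    unfolding W_def by (intro sums_divide summable_sums v_summable)
  have c_summable: "summable c"
    by (rule summable_comparison_test'[OF sums_summable[OF vW], of 0])
      (use c_le c_pos in \<open>auto simp: less_imp_le\<close>)
  have "suminf c \<le> W / (2 * (1 + W))"
    using suminf_le[OF c_le c_summable sums_summable[OF vW]] sums_unique[OF vW] by simp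
  also have "\<dots> \<le> 1 / 2" using W by (simp add: field_simps)
  finally have c_suminf: "suminf c \<le> 1 / 2" .
  have anti: "antimono c"
  proof (rule antimonoI)
    fix i j :: nat assume "i \<le> j"
    hence k: "\<kappa> i \<le> \<kappa> j" unfolding \<kappa>_def by (intro floor_log_le_iff) simp
    have "v j \<le> v i" unfolding v_def using k by (intro divide_left_mono power_increasing) auto
    thus "c j \<le> c i"
      unfolding c_def using T_mono[OF k] W v_pos[of i] T_pos[of "\<kappa> i"] by (intro frac_le mult_left_mono) auto
  qed
  \<comment> \<open>Past the threshold \<open>N\<close> of the block, the term \<open>1\<close> is
    paid for by \<open>(M n)^2\<close>; before it, \<open>n <= T (\<kappa> j)\<close> makes
    \<open>n * c j\<close> at most \<open>v j\<close>, paid for by the \<open>+ 1\<close>.\<close>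
  have min_le: "min 1 (real n * c j) \<le> v j * ((M n)\<^sup>2 + 1)" for n j
  proof (cases "n \<ge> N (\<kappa> j)")
    case True
    have "(2 ^ \<kappa> j)\<^sup>2 \<le> (M n)\<^sup>2" using N[OF True] by (intro power_mono) auto
    hence "4 ^ \<kappa> j \<le> (M n)\<^sup>2" by (simp add: power2_eq_square flip: power_mult_distrib)
    hence "1 \<le> v j * ((M n)\<^sup>2 + 1)" by (simp add: v_def)
    thus ?thesis by linarith
  next
    case False
    have "1 * T (\<kappa> j) \<le> 2 * (1 + W) * T (\<kappa> j)" using W T_pos[of "\<kappa> j"] by (intro mult_right_mono) auto
    hence nT: "real n \<le> 2 * (1 + W) * T (\<kappa> j)" using T_ge(2)[of "\<kappa> j"] False by linarith
    have "real n * c j = v j * (real n / (2 * (1 + W) * T (\<kappa> j)))" by (simp add: c_def)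
    also have "\<dots> \<le> v j * 1"
      using nT v_pos[of j] W T_pos[of "\<kappa> j"] by (intro mult_left_mono divide_le_eq_1[THEN iffD2]) auto
    also have "\<dots> \<le> v j * ((M n)\<^sup>2 + 1)" using v_pos[of j] by (intro mult_left_mono) auto
    finally show ?thesis by linarith
  qed
  show ?thesis
  proof (rule that[of c W])
    fix n
    have sm: "summable (\<lambda>j. v j * ((M n)\<^sup>2 + 1))" by (rule summable_mult2[OF v_summable])
    have "summable (\<lambda>j. min 1 (real n * c j))"
      by (rule summable_comparison_test'[OF summable_mult[OF c_summable, of "real n"], of 0])
        (use c_pos in \<open>auto simp: less_imp_le\<close>)
    hence "(\<Sum>j. min 1 (real n * c j)) \<le> (\<Sum>j. v j * ((M n)\<^sup>2 + 1))"
      by (intro suminf_le min_le sm)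
    also have "\<dots> = W * ((M n)\<^sup>2 + 1)" unfolding W_def by (rule suminf_mult2[OF v_summable, symmetric])
    finally show "(\<Sum>j. min 1 (real n * c j)) \<le> W * ((M n)\<^sup>2 + 1)" .
  next
    fix K :: nat
    \<comment> \<open>The whole block \<open>K\<close>, with \<open>2 ^ K\<close> indices and a
      common coefficient.\<close>
    let ?J = "{2 ^ K - 1..<2 * 2 ^ K - 1 :: nat}"
    have "\<kappa> j = K" if "j \<in> ?J" for j
      unfolding \<kappa>_def using that by (intro floor_log_eqI) auto
    hence "\<forall>j\<in>?J. c j = 1 / 4 ^ K / (2 * (1 + W) * T K)" by (simp add: c_def v_def)
    moreover have "card ?J \<ge> K"
      using less_exp[of K] by simp
    ultimately show "\<exists>J h. finite J \<and> card J \<ge> K \<and> (\<forall>j\<in>J. c j = h)"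
      by (intro exI[of _ ?J]) auto
  qed (use c_pos anti c_summable c_suminf W in auto)
qed

text \<open>Take \<open>d i = (e i)^2\<close> with \<open>e\<close> the running product of
  \<open>c k / 160\<close>. Then \<open>sqrt (d i)\<close> is its predecessor times
  \<open>c i / 160\<close>, and monotonicity of \<open>e\<close> extends this from the predecessor
  to all earlier indices.\<close>

lemma exists_separated_scales:
  fixes c :: "nat \<Rightarrow> real"
  assumes c: "\<And>j. c j > 0" "\<And>j. c j \<le> 1"
  obtains d :: "nat \<Rightarrow> real" where "\<And>j. d j > 0" "\<And>j. d j \<le> 1"
    "\<And>i j. j < i \<Longrightarrow> sqrt (d i) \<le> sqrt (d j) * (c i / 160)"
proof -
  define e where "e = (\<lambda>i. \<Prod>k\<le>i. c k / 160)"
  have e_pos: "e i > 0" for i unfolding e_def using c(1) by (intro prod_pos) simp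
  have e_Suc: "e (Suc i) = e i * (c (Suc i) / 160)" for i by (simp add: e_def)
  have le1: "c k / 160 \<le> 1" for k using c(2)[of k] by simp
  have e_anti: "antimono e"
  proof (rule decseq_SucI)
    show "e (Suc i) \<le> e i" for i
      unfolding e_Suc using e_pos[of i] le1[of "Suc i"] by (intro mult_left_le) auto
  qed
  show ?thesis
  proof (rule that[of "\<lambda>i. (e i)\<^sup>2"])
    show "(e j)\<^sup>2 > 0" for j using e_pos[of j] by simp
    show "(e j)\<^sup>2 \<le> 1" for j
      using e_pos[of j] c le1 unfolding e_def by (intro power_le_one prod_nonneg prod_le_1) (auto simp: less_imp_le)
    fix i j :: nat assume "j < i"
    then obtain k where k: "i = Suc k" "j \<le> k" by (cases i) auto
    have "e i \<le> e j * (c i / 160)"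
      unfolding k(1) e_Suc using antimonoD[OF e_anti k(2)] c(1) by (intro mult_right_mono) (auto simp: less_imp_le)
    thus "sqrt ((e i)\<^sup>2) \<le> sqrt ((e j)\<^sup>2) * (c i / 160)"
      using e_pos by (simp add: less_imp_le)
  qed
qed

theorem theorem1p3:
  fixes M :: "nat \<Rightarrow> real"
  assumes "\<And>n. n \<ge> 1 \<Longrightarrow> M n > 0"
    and "filterlim M at_top sequentially"
  shows "\<exists>\<phi> :: complex \<Rightarrow> complex.
           analytic_self_map \<phi> \<and> \<phi> \<in> dirichlet_space \<and>
           (\<lambda>n. dirichlet_norm (\<lambda>z. \<phi> z ^ n)) \<in> O(M) \<and>
           \<not> dirichlet_symbol \<phi>"
proof -
  obtain c W where c: "\<And>j. c j > 0" "antimono c" "summable c" "suminf c \<le> 1 / 2" "W \<ge> 0"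
    and W: "\<And>n. (\<Sum>j. min 1 (real n * c j)) \<le> W * ((M n)\<^sup>2 + 1)"
    and blocks: "\<And>K. \<exists>J h. finite J \<and> card J \<ge> K \<and> (\<forall>j\<in>J. c j = h)"
    using exists_block_coefficients[OF assms(2)] by blast
  have le: "c j \<le> suminf c" for j
    using sum_le_suminf[OF c(3), of "{j}"] c(1) by (simp add: less_imp_le)
  have "c j \<le> 1" for j using le[of j] c(4) by linarith
  then obtain d where d: "\<And>j. d j > 0" "\<And>j. d j \<le> 1"
    "\<And>i j. j < i \<Longrightarrow> sqrt (d i) \<le> sqrt (d j) * (c i / 160)"
    using exists_separated_scales[of c] c(1) by blast
  interpret separated_bump_series c d
    by unfold_locales (use c d in auto)
  \<comment> \<open>Once \<open>M n >= 1\<close>, the additive constants are absorbed in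
    \<open>(M n)^2\<close>, and \<open>1584\<close> doubles to \<open>3168\<close>.\<close>
  have "eventually (\<lambda>n. n \<ge> 1 \<and> M n \<ge> 1) sequentially"
    using assms(2) by (auto intro: eventually_conj eventually_ge_at_top simp: filterlim_at_top)
  hence "eventually (\<lambda>n. norm (dirichlet_norm (\<lambda>z. \<phi> z ^ n)) \<le> sqrt (1 + 3168 * W) * norm (M n)) sequentially"
  proof eventually_elim
    case (elim n)
    have m: "1 \<le> (M n)\<^sup>2" using elim by (simp add: one_le_power)
    have "dirichlet_norm (\<lambda>z. \<phi> z ^ n) \<le> sqrt (1 + 1584 * (W * ((M n)\<^sup>2 + 1)))"
      using elim c(5) by (intro dirichlet_norm_power_le W) auto
    also have "\<dots> \<le> sqrt ((1 + 3168 * W) * (M n)\<^sup>2)"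
    proof (rule real_sqrt_le_mono)
      have "W * 1 \<le> W * (M n)\<^sup>2" using m c(5) by (intro mult_left_mono)
      thus "1 + 1584 * (W * ((M n)\<^sup>2 + 1)) \<le> (1 + 3168 * W) * (M n)\<^sup>2" using m by (simp add: algebra_simps)
    qed
    also have "\<dots> = sqrt (1 + 3168 * W) * norm (M n)" by (simp add: real_sqrt_mult)
    finally have "dirichlet_norm (\<lambda>z. \<phi> z ^ n) \<le> sqrt (1 + 3168 * W) * norm (M n)" .
    moreover have "dirichlet_norm (\<lambda>z. \<phi> z ^ n) \<ge> 0" by (rule dirichlet_norm_nonneg)
    ultimately show ?case by simp
  qed
  hence "(\<lambda>n. dirichlet_norm (\<lambda>z. \<phi> z ^ n)) \<in> O(M)" by (rule bigoI)
  thus ?thesis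
    using \<phi>_self_map \<phi>_in_dirichlet_space not_dirichlet_symbol[OF blocks] by blast
qed

end
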